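(* Let $N\ge1$ be an integer. For any real functions $\varphi,\psi\in\ell^1(\mathbb Z^N)$ one has $$\sigma_{\rm ess}\big(T^<_\varphi+V^<_\psi\big)=\sigma\big(T^<_\varphi+V^<_\psi\big)=\bigcup_{\tau\in\mathbb T}\sigma\big(T^{N-1}_{\mu(\tau)\varphi}+V^{N-1}_{\mu(0)\psi}\big).$$
   Context: All Hilbert spaces are complex. $\mathbb N^*:=\{1,2,\dots\}$, and $\mathbb T$ is the interval $[0,1]$ with $0$ identified to $1$. $\chi_A$ denotes the characteristic function of a set $A$. Toeplitz operators. For a subset $E$ of $X=\mathbb Z^k$, $k\ge1$, and $\eta\in X$, let $(u_\eta f)(\xi):=f(\xi-\eta)$ on $\ell^2(X)$, let $P^E:\ell^2(X)\to\ell^2(E)$ be the projection given by multiplication by $\chi_E$, and set $v^E_\eta:=P^Eu_\eta\upharpoonright\ell^2(E)$. For $\varrho\in\ell^1(X)$ put $$T^E_\varrho:=\sum_{\eta\in X}\varrho(\eta)v^E_\eta,\qquad V^E_\varrho:=\sum_{\eta\in X}\varrho(\eta)v^E_\eta(v^E_\eta)^*,$$ bounded operators in $\ell^2(E)$. For $X=\mathbb Z^N$ and $E=\mathbb Z^N_<:=\{(x_1,\dots,x_N)\in\mathbb Z^N:x_1<x_2<\dots<x_N\}$ these are denoted $T^<_\varrho,V^<_\varrho$. For $X=\mathbb Z^k$ and $E=(\mathbb N^* )^k$ they are denoted $T^k_\varrho,V^k_\varrho$. For $k=0$, $\mathbb Z^0=(\mathbb N^* )^0=\{0\}$, functions are scalars,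 and $T^0_\varrho=V^0_\varrho:=\varrho\,1$ in $\ell^2(\{0\})\equiv\mathbb C$. Let $\theta^{-1}:\mathbb Z^N\to\mathbb Z^N$ be $\theta^{-1}(z_1,\dots,z_N)=(z_1,z_1+z_2,\dots,z_1+\dots+z_N)$. For $\rho\in\ell^1(\mathbb Z^N)$ and $\tau\in\mathbb T$ define $\mu(\tau)\rho\in\ell^1(\mathbb Z^{N-1})$ by $$[\mu(\tau)\rho](z_2,\dots,z_N):=\sum_{z_1\in\mathbb Z}e^{-2\pi iz_1\tau}(\rho\circ\theta^{-1})(z_1,z_2,\dots,z_N).$$ $\sigma(A)$ is the spectrum of $A$; the essential spectrum $\sigma_{\rm ess}(A)$ of a bounded operator $A$ in a Hilbert space $\mathcal G$ is the spectrum of its image in the Calkin algebra $\mathscr B(\mathcal G)/\mathscr K(\mathcal G)$, where $\mathscr K(\mathcal G)$ is the ideal of compact operators. *)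

theory Defs
  imports "HOL-Analysis.Analysis" "HOL-Algebra.QuotRing"
begin

section \<open>The Hilbert space of square summable functions\<close>

lemma square_summable_add:
  fixes f g :: "'a \<Rightarrow> complex"
  assumes "(\<lambda>x. (cmod (f x))\<^sup>2) summable_on A" "(\<lambda>x. (cmod (g x))\<^sup>2) summable_on A"
  shows "(\<lambda>x. (cmod (f x + g x))\<^sup>2) summable_on A"
proof (rule summable_on_comparison_test)
  show "(\<lambda>x. 2 * (cmod (f x))\<^sup>2 + 2 * (cmod (g x))\<^sup>2) summable_on A"
    by (intro summable_on_add summable_on_cmult_right assms)
  fix x
  have "(cmod (f x + g x))\<^sup>2 \<le> (cmod (f x) + cmod (g x))\<^sup>2"
    by (intro power_mono norm_triangle_ineq) auto
  also have "\<dots> \<le> 2 * (cmod (f x))\<^sup>2 + 2 * (cmod (g x))\<^sup>2"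
    using zero_le_power2[of "cmod (f x) - cmod (g x)"] by (simp add: power2_eq_square algebra_simps)
  finally show "(cmod (f x + g x))\<^sup>2 \<le> 2 * (cmod (f x))\<^sup>2 + 2 * (cmod (g x))\<^sup>2" .
qed auto

lemma square_summable_cmult:
  fixes f :: "'a \<Rightarrow> complex"
  assumes "(\<lambda>x. (cmod (f x))\<^sup>2) summable_on A"
  shows "(\<lambda>x. (cmod (c * f x))\<^sup>2) summable_on A"
  using summable_on_cmult_right[OF assms, of "(cmod c)\<^sup>2"] by (simp add: norm_mult power_mult_distrib)

typedef 'a ell2 = "{f :: 'a \<Rightarrow> complex. (\<lambda>x. (cmod (f x))\<^sup>2) summable_on UNIV}"
  morphisms ell2_nth Abs_ell2
  by (rule exI[of _ "\<lambda>_. 0"]) simp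

setup_lifting type_definition_ell2

lemma ell2_summable: "(\<lambda>x. (cmod (ell2_nth f x))\<^sup>2) summable_on UNIV"
  using ell2_nth[of f] by simp

lemma ell2_eqI: "(\<And>x. ell2_nth f x = ell2_nth g x) \<Longrightarrow> f = g"
  by (metis ell2_nth_inject ext)

lemma ell2_product_summable: "(\<lambda>x. cnj (ell2_nth f x) * ell2_nth g x) summable_on UNIV"
proof -
  have "(\<lambda>x. norm (cnj (ell2_nth f x) * ell2_nth g x)) summable_on UNIV"
    by (rule abs_summable_product)
       (simp_all add: norm_mult ell2_summable[unfolded power2_eq_square])
  then show ?thesis by (rule abs_summable_summable)
qed

definition cinner :: "'a ell2 \<Rightarrow> 'a ell2 \<Rightarrow> complex"
  where "cinner f g = (\<Sum>\<^sub>\<infinity>x. cnj (ell2_nth f x) * ell2_nth g x)"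

lift_definition cscale :: "complex \<Rightarrow> 'a ell2 \<Rightarrow> 'a ell2" is "\<lambda>c f x. c * f x"
  by (rule square_summable_cmult)

instantiation ell2 :: (type) real_inner
begin

lift_definition zero_ell2 :: "'a ell2" is "\<lambda>_. 0" by simp
lift_definition plus_ell2 :: "'a ell2 \<Rightarrow> 'a ell2 \<Rightarrow> 'a ell2" is "\<lambda>f g x. f x + g x"
  by (rule square_summable_add)
lift_definition uminus_ell2 :: "'a ell2 \<Rightarrow> 'a ell2" is "\<lambda>f x. - f x" by simp
lift_definition minus_ell2 :: "'a ell2 \<Rightarrow> 'a ell2 \<Rightarrow> 'a ell2" is "\<lambda>f g x. f x - g x"
  using square_summable_add[of _ _ "\<lambda>x. - g x" for g] by simp
definition scaleR_ell2 :: "real \<Rightarrow> 'a ell2 \<Rightarrow> 'a ell2"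
  where "scaleR_ell2 r f = cscale (complex_of_real r) f"
definition inner_ell2 :: "'a ell2 \<Rightarrow> 'a ell2 \<Rightarrow> real"
  where "inner_ell2 f g = Re (cinner f g)"
definition norm_ell2 :: "'a ell2 \<Rightarrow> real"
  where "norm_ell2 f = sqrt (inner f f)"
definition dist_ell2 :: "'a ell2 \<Rightarrow> 'a ell2 \<Rightarrow> real"
  where "dist_ell2 f g = norm (f - g)"
definition sgn_ell2 :: "'a ell2 \<Rightarrow> 'a ell2"
  where "sgn_ell2 f = scaleR (inverse (norm f)) f"
definition uniformity_ell2 :: "('a ell2 \<times> 'a ell2) filter"
  where "uniformity_ell2 = (INF e\<in>{0<..}. principal {(x, y). dist x y < e})"
definition open_ell2 :: "'a ell2 set \<Rightarrow> bool"
  where "open_ell2 U \<longleftrightarrow> (\<forall>x\<in>U. eventually (\<lambda>(x', y). x' = x \<longrightarrow> y \<in> U) uniformity)"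

lemma inner_ell2_eq:
  "inner f g = (\<Sum>\<^sub>\<infinity>x. Re (cnj (ell2_nth f x) * ell2_nth g x))"
  unfolding inner_ell2_def cinner_def by (rule infsum_Re[OF ell2_product_summable, symmetric])

lemma inner_ell2_summable: "(\<lambda>x. Re (cnj (ell2_nth f x) * ell2_nth g x)) summable_on UNIV"
  by (rule summable_on_Re[OF ell2_product_summable])

lemma inner_ell2_self: "inner f f = (\<Sum>\<^sub>\<infinity>x. (cmod (ell2_nth f x))\<^sup>2)"
  unfolding inner_ell2_eq
  by (rule infsum_cong) (simp add: cmod_power2 power2_eq_square[symmetric])

instance
proof
  fix x y z :: "'a ell2" and r s :: real
  show "x + y + z = x + (y + z)" by transfer (simp add: add.assoc)
  show "x + y = y + x" by transfer (simp add: add.commute)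
  show "0 + x = x" by transfer simp
  show "- x + x = 0" by transfer simp
  show "x - y = x + - y" by transfer simp
  show "r *\<^sub>R (x + y) = r *\<^sub>R x + r *\<^sub>R y"
    unfolding scaleR_ell2_def by transfer (simp add: algebra_simps)
  show "(r + s) *\<^sub>R x = r *\<^sub>R x + s *\<^sub>R x"
    unfolding scaleR_ell2_def by transfer (simp add: algebra_simps)
  show "r *\<^sub>R s *\<^sub>R x = (r * s) *\<^sub>R x"
    unfolding scaleR_ell2_def by transfer (simp add: algebra_simps)
  show "1 *\<^sub>R x = x" unfolding scaleR_ell2_def by transfer simp
  show "sgn x = scaleR (inverse (norm x)) x" by (rule sgn_ell2_def)
  show "dist x y = norm (x - y)" by (rule dist_ell2_def)
  show "(uniformity :: ('a ell2 \<times> 'a ell2) filter) = (INF e\<in>{0<..}. principal {(x, y). dist x y < e})"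
    by (rule uniformity_ell2_def)
  fix U :: "'a ell2 set"
  show "open U = (\<forall>x\<in>U. \<forall>\<^sub>F (x', y) in uniformity. x' = x \<longrightarrow> y \<in> U)" by (rule open_ell2_def)
  show "inner x y = inner y x"
    unfolding inner_ell2_eq by (rule infsum_cong) (simp add: algebra_simps)
  show "inner (x + y) z = inner x z + inner y z"
    unfolding inner_ell2_eq
    by (subst infsum_add[symmetric, OF inner_ell2_summable inner_ell2_summable])
       (intro infsum_cong, simp add: plus_ell2.rep_eq algebra_simps)
  have "(\<Sum>\<^sub>\<infinity>t. Re (cnj (ell2_nth (r *\<^sub>R x) t) * ell2_nth y t))
      = (\<Sum>\<^sub>\<infinity>t. r * Re (cnj (ell2_nth x t) * ell2_nth y t))"
    by (intro infsum_cong) (simp add: scaleR_ell2_def cscale.rep_eq algebra_simps)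
  also have "\<dots> = r * (\<Sum>\<^sub>\<infinity>t. Re (cnj (ell2_nth x t) * ell2_nth y t))"
    by (rule infsum_cmult_right[OF inner_ell2_summable])
  finally show "inner (r *\<^sub>R x) y = r * inner x y"
    unfolding inner_ell2_eq .
  show "0 \<le> inner x x" unfolding inner_ell2_self by (rule infsum_nonneg) simp
  show "inner x x = 0 \<longleftrightarrow> x = 0"
  proof
    assume "inner x x = 0"
    then have *: "(\<Sum>\<^sub>\<infinity>t. (cmod (ell2_nth x t))\<^sup>2) \<le> 0" by (simp add: inner_ell2_self)
    have "(cmod (ell2_nth x t))\<^sup>2 = 0" for t
      by (rule nonneg_infsum_le_0D[OF * ell2_summable]) auto
    then show "x = 0" by (intro ell2_eqI) (simp add: zero_ell2.rep_eq)
  qed (simp add: inner_ell2_self zero_ell2.rep_eq)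
  show "norm x = sqrt (inner x x)" by (rule norm_ell2_def)
qed

end

lemma norm_ell2_square: "(norm f)\<^sup>2 = (\<Sum>\<^sub>\<infinity>x. (cmod (ell2_nth f x))\<^sup>2)"
  by (subst power2_norm_eq_inner) (rule inner_ell2_self)

lemma norm_ell2_finite_le: "finite S \<Longrightarrow> (\<Sum>x\<in>S. (cmod (ell2_nth f x))\<^sup>2) \<le> (norm f)\<^sup>2"
  unfolding norm_ell2_square by (rule finite_sum_le_infsum[OF ell2_summable]) auto

lemma ell2_nth_norm_le: "cmod (ell2_nth f x) \<le> norm f"
  using norm_ell2_finite_le[of "{x}" f] by (simp add: power2_le_iff_abs_le)

lemma ell2_boundedI:
  assumes "\<And>S. finite S \<Longrightarrow> (\<Sum>x\<in>S. (cmod (g x))\<^sup>2) \<le> e\<^sup>2" and "0 \<le> e"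
  obtains h where "ell2_nth h = g" and "norm h \<le> e"
proof -
  have sm: "(\<lambda>x. (cmod (g x))\<^sup>2) summable_on UNIV"
    by (rule nonneg_bdd_above_summable_on) (auto intro!: bdd_aboveI2 assms)
  then have h: "ell2_nth (Abs_ell2 g) = g" by (simp add: Abs_ell2_inverse)
  have "(norm (Abs_ell2 g))\<^sup>2 \<le> e\<^sup>2"
    unfolding norm_ell2_square h by (rule infsum_le_finite_sums[OF sm]) (auto intro: assms)
  then have "norm (Abs_ell2 g) \<le> e" using assms(2) by (rule power2_le_imp_le)
  with h show ?thesis by (rule that)
qed

instance ell2 :: (type) banach
proof
  fix F :: "nat \<Rightarrow> 'a ell2"
  assume "Cauchy F"
  have "Cauchy (\<lambda>n. ell2_nth (F n) x)" for x
  proof (rule CauchyI)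
    fix e :: real assume "0 < e"
    then obtain M where M: "\<And>m n. m \<ge> M \<Longrightarrow> n \<ge> M \<Longrightarrow> norm (F m - F n) < e"
      using CauchyD[OF \<open>Cauchy F\<close>] by blast
    have "norm (ell2_nth (F m) x - ell2_nth (F n) x) < e" if "m \<ge> M" "n \<ge> M" for m n
      using ell2_nth_norm_le[of "F m - F n" x] M[OF that] by (simp add: minus_ell2.rep_eq)
    then show "\<exists>M. \<forall>m\<ge>M. \<forall>n\<ge>M. norm (ell2_nth (F m) x - ell2_nth (F n) x) < e" by blast
  qed
  then have "\<forall>x. \<exists>l. (\<lambda>n. ell2_nth (F n) x) \<longlonglongrightarrow> l"
    by (meson Cauchy_convergent convergent_def)
  then obtain g where g: "\<And>x. (\<lambda>n. ell2_nth (F n) x) \<longlonglongrightarrow> g x" by metis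
  have key: "\<exists>M. \<forall>n\<ge>M. \<exists>h. ell2_nth h = (\<lambda>x. g x - ell2_nth (F n) x) \<and> norm h \<le> e"
    if e: "0 < e" for e :: real
  proof -
    obtain M where M: "\<And>m n. m \<ge> M \<Longrightarrow> n \<ge> M \<Longrightarrow> norm (F m - F n) < e"
      using CauchyD[OF \<open>Cauchy F\<close> e] by blast
    have "\<exists>h. ell2_nth h = (\<lambda>x. g x - ell2_nth (F n) x) \<and> norm h \<le> e" if n: "n \<ge> M" for n
    proof -
      have "(\<Sum>x\<in>S. (cmod (g x - ell2_nth (F n) x))\<^sup>2) \<le> e\<^sup>2" if S: "finite S" for S
      proof (rule LIMSEQ_le_const2)
        show "(\<lambda>m. \<Sum>x\<in>S. (cmod (ell2_nth (F m) x - ell2_nth (F n) x))\<^sup>2)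
              \<longlonglongrightarrow> (\<Sum>x\<in>S. (cmod (g x - ell2_nth (F n) x))\<^sup>2)"
          by (intro tendsto_intros g)
        have "(\<Sum>x\<in>S. (cmod (ell2_nth (F m) x - ell2_nth (F n) x))\<^sup>2) \<le> e\<^sup>2" if m: "m \<ge> M" for m
        proof -
          have "(\<Sum>x\<in>S. (cmod (ell2_nth (F m) x - ell2_nth (F n) x))\<^sup>2) \<le> (norm (F m - F n))\<^sup>2"
            using norm_ell2_finite_le[OF S, of "F m - F n"] by (simp add: minus_ell2.rep_eq)
          also have "\<dots> \<le> e\<^sup>2" using M[OF m n] by (intro power_mono) auto
          finally show ?thesis .
        qed
        then show "\<exists>N. \<forall>m\<ge>N. (\<Sum>x\<in>S. (cmod (ell2_nth (F m) x - ell2_nth (F n) x))\<^sup>2) \<le> e\<^sup>2" by blast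
      qed
      then show ?thesis using e ell2_boundedI[of "\<lambda>x. g x - ell2_nth (F n) x" e] by (metis less_imp_le)
    qed
    then show ?thesis by blast
  qed
  obtain M h where "ell2_nth h = (\<lambda>x. g x - ell2_nth (F M) x)"
    using key[of 1] by (metis order_refl zero_less_one)
  then have G: "ell2_nth (h + F M) = g" by (simp add: plus_ell2.rep_eq)
  have "F \<longlonglongrightarrow> h + F M"
  proof (rule LIMSEQ_I)
    fix r :: real assume r: "0 < r"
    then obtain N where N: "\<And>n. n \<ge> N \<Longrightarrow>
        \<exists>k. ell2_nth k = (\<lambda>x. g x - ell2_nth (F n) x) \<and> norm k \<le> r / 2"
      using key[of "r / 2"] by auto
    have "norm (F n - (h + F M)) < r" if n: "n \<ge> N" for n
    proof -
      obtain k where k: "ell2_nth k = (\<lambda>x. g x - ell2_nth (F n) x)" "norm k \<le> r / 2"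
        using N[OF n] by blast
      have "k = (h + F M) - F n" by (rule ell2_eqI) (simp only: minus_ell2.rep_eq G k(1))
      then show ?thesis using k(2) r by (simp add: norm_minus_commute)
    qed
    then show "\<exists>no. \<forall>n\<ge>no. norm (F n - (h + F M)) < r" by blast
  qed
  then show "convergent F" by (auto simp: convergent_def)
qed

section \<open>Bounded operators, spectrum and essential spectrum\<close>

lemma bounded_linear_ell2I:
  fixes T :: "'a ell2 \<Rightarrow> 'b ell2"
  assumes "\<And>f g. T (f + g) = T f + T g" "\<And>c f. T (cscale c f) = cscale c (T f)"
    and "\<And>f. norm (T f) \<le> norm f * K"
  shows "bounded_linear T"
  by (rule bounded_linear_intro[of _ K]) (simp_all add: assms scaleR_ell2_def)

lemma norm_cscale: "norm (cscale c f) = cmod c * norm f"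
proof (rule power2_eq_imp_eq)
  show "(norm (cscale c f))\<^sup>2 = (cmod c * norm f)\<^sup>2"
    unfolding power_mult_distrib norm_ell2_square
    by (simp add: infsum_cmult_right[OF ell2_summable, symmetric]
        cscale.rep_eq norm_mult power_mult_distrib)
qed auto

lift_definition cscale_op :: "complex \<Rightarrow> 'a ell2 \<Rightarrow>\<^sub>L 'a ell2" is cscale
proof (rule bounded_linear_ell2I)
  show "norm (cscale c f) \<le> norm f * cmod c" for c and f :: "'a ell2" by (simp add: norm_cscale)
qed (transfer, simp add: algebra_simps)+

definition is_clinear :: "('a ell2 \<Rightarrow>\<^sub>L 'a ell2) \<Rightarrow> bool"
  where "is_clinear A \<longleftrightarrow> (\<forall>c f. blinfun_apply A (cscale c f) = cscale c (blinfun_apply A f))"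

definition cadjoint :: "('a ell2 \<Rightarrow>\<^sub>L 'a ell2) \<Rightarrow> 'a ell2 \<Rightarrow>\<^sub>L 'a ell2"
  where "cadjoint A = (THE B. \<forall>f g. cinner (blinfun_apply B f) g = cinner f (blinfun_apply A g))"

lift_definition ell2_restrict :: "'a set \<Rightarrow> 'a ell2 \<Rightarrow> 'a ell2"
  is "\<lambda>E f x. if x \<in> E then f x else 0"
  by (erule summable_on_comparison_test) auto

lift_definition proj :: "'a set \<Rightarrow> 'a ell2 \<Rightarrow>\<^sub>L 'a ell2" is ell2_restrict
proof (rule bounded_linear_ell2I)
  show "norm (ell2_restrict E f) \<le> norm f * 1" for E and f :: "'a ell2"
  proof (rule power2_le_imp_le)
    show "(norm (ell2_restrict E f))\<^sup>2 \<le> (norm f * 1)\<^sup>2"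
      unfolding norm_ell2_square mult_1_right
      by (intro infsum_mono ell2_summable) (simp add: ell2_restrict.rep_eq)
  qed simp
qed (transfer, auto)+

text \<open>
  A bounded operator on the space of square summable functions on \<open>E\<close> is identified with its
  extension by zero on the orthogonal complement, that is, with a bounded complex-linear \<open>A\<close> such
  that \<open>A = P A P\<close>, where \<open>P\<close> is the projection onto functions supported in \<open>E\<close>. The
  identification preserves operator norms, adjoints and compactness; the identity operator becomes \<open>P\<close>.
\<close>

definition bounded_ops :: "'a set \<Rightarrow> ('a ell2 \<Rightarrow>\<^sub>L 'a ell2) ring"
  where "bounded_ops E =
    \<lparr>carrier = {A. is_clinear A \<and> proj E o\<^sub>L A o\<^sub>L proj E = A},
     monoid.mult = (o\<^sub>L), one = proj E, ring.zero = 0, add = (+)\<rparr>"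

definition compact_ops :: "'a set \<Rightarrow> ('a ell2 \<Rightarrow>\<^sub>L 'a ell2) set"
  where "compact_ops E =
    {A \<in> carrier (bounded_ops E). compact (closure (blinfun_apply A ` cball 0 1))}"

definition calkin :: "'a set \<Rightarrow> ('a ell2 \<Rightarrow>\<^sub>L 'a ell2) set ring"
  where "calkin E = bounded_ops E Quot compact_ops E"

definition to_calkin :: "'a set \<Rightarrow> ('a ell2 \<Rightarrow>\<^sub>L 'a ell2) \<Rightarrow> ('a ell2 \<Rightarrow>\<^sub>L 'a ell2) set"
  where "to_calkin E A = compact_ops E +>\<^bsub>bounded_ops E\<^esub> A"

text \<open>Spectrum of \<open>a\<close> in a unital algebra \<open>R\<close>, where \<open>u z\<close> is \<open>z\<close> times the unit of \<open>R\<close>.\<close>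

definition algebra_spectrum :: "('r, 'm) ring_scheme \<Rightarrow> (complex \<Rightarrow> 'r) \<Rightarrow> 'r \<Rightarrow> complex set"
  where "algebra_spectrum R u a = {z. a \<ominus>\<^bsub>R\<^esub> u z \<notin> Units R}"

definition spectrum :: "'a set \<Rightarrow> ('a ell2 \<Rightarrow>\<^sub>L 'a ell2) \<Rightarrow> complex set"
  where "spectrum E A = algebra_spectrum (bounded_ops E) (\<lambda>z. cscale_op z o\<^sub>L proj E) A"

definition ess_spectrum :: "'a set \<Rightarrow> ('a ell2 \<Rightarrow>\<^sub>L 'a ell2) \<Rightarrow> complex set"
  where "ess_spectrum E A =
    algebra_spectrum (calkin E) (\<lambda>z. to_calkin E (cscale_op z o\<^sub>L proj E)) (to_calkin E A)"

lemma blinfun_compose_assoc: "(A o\<^sub>L B) o\<^sub>L C = A o\<^sub>L (B o\<^sub>L C)"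
  by (rule blinfun_eqI) simp

lemmas blinfun_compose_add_left = bounded_bilinear.add_left[OF bounded_bilinear_blinfun_compose]
  and blinfun_compose_add_right = bounded_bilinear.add_right[OF bounded_bilinear_blinfun_compose]
  and blinfun_compose_minus_left = bounded_bilinear.minus_left[OF bounded_bilinear_blinfun_compose]
  and blinfun_compose_minus_right = bounded_bilinear.minus_right[OF bounded_bilinear_blinfun_compose]

lemma proj_apply: "ell2_nth (blinfun_apply (proj E) f) x = (if x \<in> E then ell2_nth f x else 0)"
  by (simp add: proj.rep_eq ell2_restrict.rep_eq)

lemma proj_idem: "proj E o\<^sub>L proj E = proj E"
  by (intro blinfun_eqI ell2_eqI) (simp add: proj_apply)

lemma is_clinear_proj: "is_clinear (proj E)"
  unfolding is_clinear_def by (intro allI ell2_eqI) (simp add: proj_apply cscale.rep_eq)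

lemma cscale_add: "cscale c (f + g) = cscale c f + cscale c g"
  by transfer (simp add: algebra_simps)

lemma cscale_zero: "cscale c 0 = 0"
  by transfer simp

lemma cscale_minus: "cscale c (- f) = - cscale c f"
  by transfer simp

lemma bounded_ops_left: "A \<in> carrier (bounded_ops E) \<Longrightarrow> proj E o\<^sub>L A = A"
  unfolding bounded_ops_def using proj_idem[of E] by (simp, metis blinfun_compose_assoc)

lemma bounded_ops_right: "A \<in> carrier (bounded_ops E) \<Longrightarrow> A o\<^sub>L proj E = A"
  unfolding bounded_ops_def using proj_idem[of E] by (simp, metis blinfun_compose_assoc)

lemma bounded_opsI:
  "is_clinear A \<Longrightarrow> proj E o\<^sub>L A = A \<Longrightarrow> A o\<^sub>L proj E = A \<Longrightarrow> A \<in> carrier (bounded_ops E)"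
  unfolding bounded_ops_def by simp

lemma bounded_ops_clinear: "A \<in> carrier (bounded_ops E) \<Longrightarrow> is_clinear A"
  unfolding bounded_ops_def by simp

lemma bounded_ops_simps [simp]:
  "x \<otimes>\<^bsub>bounded_ops E\<^esub> y = x o\<^sub>L y" "\<one>\<^bsub>bounded_ops E\<^esub> = proj E"
  "\<zero>\<^bsub>bounded_ops E\<^esub> = 0" "x \<oplus>\<^bsub>bounded_ops E\<^esub> y = x + y"
  by (simp_all add: bounded_ops_def)

lemma bounded_ops_add:
  assumes "A \<in> carrier (bounded_ops E)" "B \<in> carrier (bounded_ops E)"
  shows "A + B \<in> carrier (bounded_ops E)"
proof (rule bounded_opsI)
  show "is_clinear (A + B)" using assms[THEN bounded_ops_clinear]
    by (simp add: is_clinear_def blinfun.add_left cscale_add)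
qed (simp_all add: blinfun_compose_add_left blinfun_compose_add_right
       assms[THEN bounded_ops_left] assms[THEN bounded_ops_right])

lemma bounded_ops_uminus:
  assumes "A \<in> carrier (bounded_ops E)"
  shows "- A \<in> carrier (bounded_ops E)"
proof (rule bounded_opsI)
  show "is_clinear (- A)" using assms[THEN bounded_ops_clinear]
    by (simp add: is_clinear_def blinfun.minus_left cscale_minus)
qed (simp_all add: blinfun_compose_minus_left blinfun_compose_minus_right
       assms[THEN bounded_ops_left] assms[THEN bounded_ops_right])

lemma bounded_ops_mult:
  assumes "A \<in> carrier (bounded_ops E)" "B \<in> carrier (bounded_ops E)"
  shows "A o\<^sub>L B \<in> carrier (bounded_ops E)"
proof (rule bounded_opsI)
  show "is_clinear (A o\<^sub>L B)" using assms[THEN bounded_ops_clinear] by (simp add: is_clinear_def)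
  show "proj E o\<^sub>L (A o\<^sub>L B) = A o\<^sub>L B"
    by (simp add: blinfun_compose_assoc[symmetric] bounded_ops_left assms)
  show "A o\<^sub>L B o\<^sub>L proj E = A o\<^sub>L B"
    by (simp add: blinfun_compose_assoc bounded_ops_right assms)
qed

lemma bounded_ops_zero: "0 \<in> carrier (bounded_ops E)"
  by (rule bounded_opsI) (auto simp: is_clinear_def cscale_zero)

lemma bounded_ops_proj: "proj E \<in> carrier (bounded_ops E)"
  by (rule bounded_opsI) (auto simp: is_clinear_proj proj_idem)

lemma ring_bounded_ops: "ring (bounded_ops E)"
proof (rule ringI)
  show "abelian_group (bounded_ops E)"
  proof (rule abelian_groupI)
    show "\<exists>y\<in>carrier (bounded_ops E). y \<oplus>\<^bsub>bounded_ops E\<^esub> x = \<zero>\<^bsub>bounded_ops E\<^esub>"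
      if "x \<in> carrier (bounded_ops E)" for x
      using bounded_ops_uminus[OF that] by (intro bexI[of _ "- x"]) auto
  qed (auto simp: bounded_ops_add bounded_ops_zero)
  show "monoid (bounded_ops E)"
    by (rule monoidI)
       (auto simp: bounded_ops_mult bounded_ops_proj bounded_ops_left bounded_ops_right
          blinfun_compose_assoc)
qed (auto simp: blinfun_compose_add_left blinfun_compose_add_right)

lemma compact_opsI:
  assumes "A \<in> carrier (bounded_ops E)" "compact K" "blinfun_apply A ` cball 0 1 \<subseteq> K"
  shows "A \<in> compact_ops E"
proof -
  have "closure (blinfun_apply A ` cball 0 1) \<subseteq> K"
    using assms(2,3) by (intro closure_minimal compact_imp_closed)
  then have "compact (closure (blinfun_apply A ` cball 0 1))"
    using compact_Int_closed[OF assms(2) closed_closure] by (metis Int_absorb1)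
  with assms(1) show ?thesis by (simp add: compact_ops_def)
qed

lemma compact_opsD:
  assumes "A \<in> compact_ops E"
  obtains K where "compact K" "blinfun_apply A ` cball 0 1 \<subseteq> K"
proof (rule that)
  show "compact (closure (blinfun_apply A ` cball 0 1))"
    using assms by (simp add: compact_ops_def)
qed (rule closure_subset)

lemma ideal_compact_ops: "ideal (compact_ops E) (bounded_ops E)"
proof (rule idealI)
  interpret ring "bounded_ops E" by (rule ring_bounded_ops)
  show "ring (bounded_ops E)" by (rule ring_bounded_ops)
  have uminus: "- A \<in> compact_ops E" if A: "A \<in> compact_ops E" for A
  proof -
    obtain K where K: "compact K" "blinfun_apply A ` cball 0 1 \<subseteq> K" using A by (rule compact_opsD)
    have "blinfun_apply (- A) ` cball 0 1 \<subseteq> uminus ` K" using K(2) by (auto simp: blinfun.minus_left)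
    moreover have "- A \<in> carrier (bounded_ops E)"
      using A by (simp add: compact_ops_def bounded_ops_uminus)
    ultimately show ?thesis using compact_negations[OF K(1)] by (intro compact_opsI)
  qed
  show "subgroup (compact_ops E) (add_monoid (bounded_ops E))"
  proof (rule add.subgroupI)
    show "compact_ops E \<subseteq> carrier (bounded_ops E)" by (auto simp: compact_ops_def)
    have "0 \<in> compact_ops E"
      by (rule compact_opsI[where K = "{0}"]) (auto simp: bounded_ops_zero)
    then show "compact_ops E \<noteq> {}" by blast
    fix A assume A: "A \<in> compact_ops E"
    have "\<ominus>\<^bsub>bounded_ops E\<^esub> A = - A"
      using A by (intro minus_equality) (auto simp: compact_ops_def bounded_ops_uminus)
    then show "\<ominus>\<^bsub>bounded_ops E\<^esub> A \<in> compact_ops E" using uminus[OF A] by simp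
    fix B assume B: "B \<in> compact_ops E"
    obtain K where K: "compact K" "blinfun_apply A ` cball 0 1 \<subseteq> K" using A by (rule compact_opsD)
    obtain L where L: "compact L" "blinfun_apply B ` cball 0 1 \<subseteq> L" using B by (rule compact_opsD)
    have "blinfun_apply (A + B) ` cball 0 1 \<subseteq> {x + y |x y. x \<in> K \<and> y \<in> L}"
      using K(2) L(2) by (fastforce simp: blinfun.add_left)
    moreover have "A + B \<in> carrier (bounded_ops E)"
      using A B by (simp add: compact_ops_def bounded_ops_add)
    ultimately have "A + B \<in> compact_ops E"
      using compact_sums[OF K(1) L(1)] by (intro compact_opsI)
    then show "A \<oplus>\<^bsub>bounded_ops E\<^esub> B \<in> compact_ops E" by simp
  qed
  fix A B assume A: "A \<in> compact_ops E" and B: "B \<in> carrier (bounded_ops E)"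
  have A': "A \<in> carrier (bounded_ops E)" using A by (simp add: compact_ops_def)
  obtain K where K: "compact K" "blinfun_apply A ` cball 0 1 \<subseteq> K" using A by (rule compact_opsD)
  have "compact (blinfun_apply B ` K)"
    by (intro compact_continuous_image K(1) continuous_intros)
  then have "B o\<^sub>L A \<in> compact_ops E"
    using K(2) by (intro compact_opsI[of _ _ "blinfun_apply B ` K"] bounded_ops_mult A' B) auto
  then show "B \<otimes>\<^bsub>bounded_ops E\<^esub> A \<in> compact_ops E" by simp
  define c where "c = norm B + 1"
  have c: "c > 0" unfolding c_def by (simp add: add_nonneg_pos)
  have "blinfun_apply (A o\<^sub>L B) f \<in> (\<lambda>g. c *\<^sub>R g) ` K" if f: "f \<in> cball 0 1" for f
  proof -
    have "norm (blinfun_apply B f) \<le> norm B * norm f" by (rule norm_blinfun)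
    also have "\<dots> \<le> norm B * 1" using f by (intro mult_left_mono) auto
    also have "\<dots> \<le> c" by (simp add: c_def)
    finally have "norm (blinfun_apply B f) \<le> c" .
    then have "inverse c *\<^sub>R blinfun_apply B f \<in> cball 0 1"
      using c by (simp add: field_simps)
    then have "blinfun_apply A (inverse c *\<^sub>R blinfun_apply B f) \<in> K" using K(2) by blast
    moreover have "blinfun_apply (A o\<^sub>L B) f = c *\<^sub>R blinfun_apply A (inverse c *\<^sub>R blinfun_apply B f)"
      using c by (simp add: blinfun.scaleR_right)
    ultimately show ?thesis by blast
  qed
  then have "A o\<^sub>L B \<in> compact_ops E" using compact_scaling[OF K(1), of c]
    by (intro compact_opsI[of _ _ "(\<lambda>g. c *\<^sub>R g) ` K"] bounded_ops_mult A' B) auto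
  then show "A \<otimes>\<^bsub>bounded_ops E\<^esub> B \<in> compact_ops E" by simp
qed

lemma ring_calkin: "ring (calkin E)"
  unfolding calkin_def by (rule ideal.quotient_is_ring[OF ideal_compact_ops])

section \<open>Toeplitz operators\<close>

text \<open>Elements of \<open>\<int>\<^sup>k\<close> are integer lists of length \<open>k\<close>; for \<open>k = 0\<close> the only point is the empty list.\<close>

definition Zpow :: "nat \<Rightarrow> int list set"
  where "Zpow k = {x. length x = k}"

definition Zless :: "nat \<Rightarrow> int list set"
  where "Zless n = {x \<in> Zpow n. sorted_wrt (<) x}"

definition Nstar_pow :: "nat \<Rightarrow> int list set"
  where "Nstar_pow k = {x \<in> Zpow k. \<forall>i<k. 1 \<le> x ! i}"

lemma inj_on_translate: "inj_on (\<lambda>\<xi>. map2 (-) \<xi> \<eta>) (Zpow (length \<eta>))"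
proof (rule inj_onI)
  fix x y assume xy: "x \<in> Zpow (length \<eta>)" "y \<in> Zpow (length \<eta>)"
    and eq: "map2 (-) x \<eta> = map2 (-) y \<eta>"
  show "x = y"
  proof (rule nth_equalityI)
    fix i assume i: "i < length x"
    then have "map2 (-) x \<eta> ! i = map2 (-) y \<eta> ! i" using eq by simp
    then show "x ! i = y ! i" using i xy by (simp add: Zpow_def)
  qed (use xy in \<open>simp add: Zpow_def\<close>)
qed

lemma translate_square_summable:
  fixes f :: "int list \<Rightarrow> complex" and \<eta> :: "int list"
  assumes f: "(\<lambda>x. (cmod (f x))\<^sup>2) summable_on UNIV"
  defines "g \<equiv> \<lambda>\<xi>. (cmod (if \<xi> \<in> Zpow (length \<eta>) then f (map2 (-) \<xi> \<eta>) else 0))\<^sup>2"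
  shows "g summable_on UNIV" and "infsum g UNIV \<le> (\<Sum>\<^sub>\<infinity>x. (cmod (f x))\<^sup>2)"
proof -
  let ?Z = "Zpow (length \<eta>)" and ?h = "\<lambda>\<xi>. map2 (-) \<xi> \<eta>" and ?F = "\<lambda>x. (cmod (f x))\<^sup>2"
  have F: "?F summable_on ?h ` ?Z" by (rule summable_on_subset_banach[OF f]) simp
  then have "(?F \<circ> ?h) summable_on ?Z" by (simp only: summable_on_reindex[OF inj_on_translate])
  moreover have "(?F \<circ> ?h) summable_on ?Z \<longleftrightarrow> g summable_on UNIV"
    by (rule summable_on_cong_neutral) (auto simp: g_def)
  ultimately show "g summable_on UNIV" by simp
  have "infsum g UNIV = infsum (?F \<circ> ?h) ?Z"
    by (rule infsum_cong_neutral) (auto simp: g_def)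
  also have "\<dots> = infsum ?F (?h ` ?Z)" by (rule infsum_reindex[OF inj_on_translate, symmetric])
  also have "\<dots> \<le> infsum ?F UNIV" by (rule infsum_mono2[OF F f]) auto
  finally show "infsum g UNIV \<le> infsum ?F UNIV" .
qed

text \<open>Translation by \<open>\<eta> \<in> \<int>\<^sup>k\<close> on square summable functions on \<open>\<int>\<^sup>k\<close>, extended by zero.\<close>

lift_definition ell2_translate :: "int list \<Rightarrow> int list ell2 \<Rightarrow> int list ell2"
  is "\<lambda>\<eta> f \<xi>. if \<xi> \<in> Zpow (length \<eta>) then f (map2 (-) \<xi> \<eta>) else 0"
  by (rule translate_square_summable(1))

lift_definition translate :: "int list \<Rightarrow> int list ell2 \<Rightarrow>\<^sub>L int list ell2" is ell2_translate
proof (rule bounded_linear_ell2I)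
  show "norm (ell2_translate \<eta> f) \<le> norm f * 1" for \<eta> f
  proof (rule power2_le_imp_le)
    show "(norm (ell2_translate \<eta> f))\<^sup>2 \<le> (norm f * 1)\<^sup>2"
      unfolding norm_ell2_square mult_1_right ell2_translate.rep_eq
      by (rule translate_square_summable(2)[OF ell2_summable])
  qed simp
qed (transfer, auto)+

definition compressed_translate :: "int list set \<Rightarrow> int list \<Rightarrow> int list ell2 \<Rightarrow>\<^sub>L int list ell2"
  where "compressed_translate E \<eta> = proj E o\<^sub>L translate \<eta> o\<^sub>L proj E"

text \<open>For \<open>E \<subseteq> \<int>\<^sup>k\<close>; the series are sums in operator norm.\<close>

definition toeplitz_T :: "nat \<Rightarrow> int list set \<Rightarrow> (int list \<Rightarrow> complex) \<Rightarrow> int list ell2 \<Rightarrow>\<^sub>L int list ell2"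
  where "toeplitz_T k E \<rho> =
    (\<Sum>\<^sub>\<infinity>\<eta>\<in>Zpow k. cscale_op (\<rho> \<eta>) o\<^sub>L compressed_translate E \<eta>)"

definition toeplitz_V :: "nat \<Rightarrow> int list set \<Rightarrow> (int list \<Rightarrow> complex) \<Rightarrow> int list ell2 \<Rightarrow>\<^sub>L int list ell2"
  where "toeplitz_V k E \<rho> =
    (\<Sum>\<^sub>\<infinity>\<eta>\<in>Zpow k. cscale_op (\<rho> \<eta>) o\<^sub>L
       (compressed_translate E \<eta> o\<^sub>L cadjoint (compressed_translate E \<eta>)))"

definition theta_inv :: "int list \<Rightarrow> int list"
  where "theta_inv z = map (\<lambda>j. \<Sum>i\<le>j. z ! i) [0..<length z]"

text \<open>The argument \<open>z\<close> consists of \<open>z\<^sub>2, \<dots>, z\<^sub>N\<close>; the first coordinate is summed out.\<close>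

definition mu :: "real \<Rightarrow> (int list \<Rightarrow> complex) \<Rightarrow> int list \<Rightarrow> complex"
  where "mu \<tau> \<rho> z =
    (\<Sum>\<^sub>\<infinity>z1\<in>(UNIV :: int set). cis (- 2 * pi * of_int z1 * \<tau>) * \<rho> (theta_inv (z1 # z)))"

end

theory Submission
  imports Defs
begin

text \<open>
  Let \<open>E\<close> be the cone of strictly increasing points and \<open>F = (\<nat>\<^sup>*)\<^sup>N\<^sup>-\<^sup>1\<close>. Passing from a point to its first
  coordinate and its increments identifies \<open>E\<close> with \<open>\<int> \<times> F\<close>. The compressed translation by \<open>\<eta>\<close>
  becomes the shift by \<open>\<eta>\<^sub>1\<close> along \<open>\<int>\<close> tensored with the compressed translation of \<open>F\<close> by the increments
  of \<open>\<eta>\<close>, and the projection onto \<open>E \<inter> (E + \<eta>)\<close> acts on the factor \<open>F\<close> alone. So \<open>T + V\<close> is a Laurent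
  operator \<open>\<Sum> S\<^sup>d \<otimes> Y\<close> with \<open>S\<close> the bilateral shift and an absolutely convergent sum, and its symbol
  \<open>\<Sum> exp (- 2 \<pi> i d \<tau>) Y\<close> is the operator on \<open>F\<close> that belongs to \<open>\<mu>(\<tau>)\<phi>\<close> and \<open>\<mu>(0)\<psi>\<close>; the \<open>V\<close> part has
  \<open>d = 0\<close> throughout, which is where \<open>\<mu>(0)\<close> comes from. This is \<open>laurent_toeplitz_op\<close>, with the
  regrouping of the sums in \<open>weighted_sum_mu\<close>.

  The theorem is then the chain of inclusions
  \<open>\<sigma>(symbol at \<tau>) \<subseteq> \<sigma>\<^sub>e\<^sub>s\<^sub>s(T + V) \<subseteq> \<sigma>(T + V) \<subseteq> \<Union>\<^sub>\<tau> \<sigma>(symbol at \<tau>)\<close>, whose middle part holds for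
  the passage to any quotient algebra. The operators need not be normal, so invertibility is
  read off from two lower bounds, one for the operator and one for its adjoint (\<open>bounded_ops_unitI\<close>). The adjoint is
  again of the form considered, with \<open>\<phi>\<close> replaced by the conjugate of its reflection
  and \<open>\<psi>\<close> by its conjugate, and passing to symbols commutes with this.

  For the first inclusion a vector \<open>g\<close> on \<open>F\<close> is spread over a long window of \<open>\<int>\<close> as a plane wave of
  frequency \<open>\<tau>\<close>. A Laurent operator sends such a packet, up to a small error at the two ends of the
  window, to the packet of the symbol applied to \<open>g\<close> (\<open>laurent_packet\<close>). Packets over disjoint
  windows are orthogonal, so a compact operator makes some of them small (\<open>compact_op_orthogonal\<close>),
  and an inverse modulo compact operators yields lower bounds for the symbol and its adjoint
  (\<open>fredholm_left_symbol\<close>, \<open>fredholm_right_symbol\<close>). For the last inclusion, invertible symbols are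
  bounded below uniformly in \<open>\<tau>\<close>, because \<open>[0,1]\<close> is compact and the symbol is norm continuous, and
  Parseval's identity along \<open>\<int>\<close> transports the bound to the Laurent operator
  (\<open>laurent_lower_bound\<close>).
\<close>

section \<open>Invertible and Fredholm operators\<close>

text \<open>
  Stated with the real inner product, from which the identity for the complex one follows for complex
  linear operators (\<open>cadjoint_eqI\<close>).
\<close>

definition formal_adjoint :: "('a ell2 \<Rightarrow>\<^sub>L 'a ell2) \<Rightarrow> ('a ell2 \<Rightarrow>\<^sub>L 'a ell2) \<Rightarrow> bool"
  where "formal_adjoint X X' \<longleftrightarrow> (\<forall>u v. inner (X u) v = inner u (X' v))"

definition bounded_below :: "'a set \<Rightarrow> ('a ell2 \<Rightarrow>\<^sub>L 'a ell2) \<Rightarrow> bool"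
  where "bounded_below E X \<longleftrightarrow> (\<exists>c>0. \<forall>u. proj E u = u \<longrightarrow> c * norm u \<le> norm (X u))"

lemma formal_adjoint_sym: "formal_adjoint X X' \<Longrightarrow> formal_adjoint X' X"
  unfolding formal_adjoint_def by (metis inner_commute)

lemma blinfun_compose_eq_apply: "A o\<^sub>L B = C \<Longrightarrow> A (B x) = C x"
  by (metis blinfun_apply_blinfun_compose)

lemma norm_proj_apply_le: "norm (proj E u) \<le> norm u"
proof (rule power2_le_imp_le)
  show "(norm (proj E u))\<^sup>2 \<le> (norm u)\<^sup>2"
    unfolding norm_ell2_square
    by (intro infsum_mono ell2_summable) (simp add: proj_apply)
qed simp

lemma norm_proj_le: "norm (proj E :: 'a ell2 \<Rightarrow>\<^sub>L 'a ell2) \<le> 1"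
  by (rule norm_blinfun_bound) (simp_all add: norm_proj_apply_le)

text \<open>
  The lower bound on \<open>X'\<close> makes \<open>X X'\<close> strictly positive, so that for small \<open>t > 0\<close> the operator
  \<open>1 - t X X'\<close> is a strict contraction. A solution of \<open>X X' f = g\<close> is then a fixed point of
  \<open>f \<mapsto> f - t X X' f + t g\<close>.
\<close>

lemma surjective_if_adjoint_bounded_below:
  assumes X: "X \<in> carrier (bounded_ops E)" and adj: "formal_adjoint X X'"
    and low: "bounded_below E X'" and g: "proj E g = g"
  shows "\<exists>f. proj E f = f \<and> X f = g"
proof -
  obtain c where c: "c > 0" "\<And>u. proj E u = u \<Longrightarrow> c * norm u \<le> norm (X' u)"
    using low unfolding bounded_below_def by blast
  \<comment> \<open>Adding \<open>c\<close> to the norm ensures \<open>c \<le> C\<close>, hence \<open>0 \<le> 1 - t c\<^sup>2\<close> for \<open>t = 1 / C\<^sup>2\<close>.\<close>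
  define C where "C = norm X + c"
  have C: "C > 0" "norm X \<le> C" "c \<le> C" using c(1) by (auto simp: C_def add_nonneg_pos)
  define t where "t = 1 / C\<^sup>2"
  define q where "q = sqrt (1 - t * c\<^sup>2)"
  have t: "t > 0" "t * C\<^sup>2 = 1" using C(1) by (auto simp: t_def)
  have tc: "0 < t * c\<^sup>2" "t * c\<^sup>2 \<le> 1"
    using C c(1) t by (auto simp: t_def divide_simps intro: power_mono)
  have q: "0 \<le> q" "q < 1" "q\<^sup>2 = 1 - t * c\<^sup>2" using tc by (auto simp: q_def)
  \<comment> \<open>The leading projection forces every fixed point to be supported in \<open>E\<close>.\<close>
  define D where "D = proj E - t *\<^sub>R (X o\<^sub>L X' o\<^sub>L proj E)"
  have P: "proj E (proj E u) = proj E u" for u :: "'a ell2"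
    by (rule blinfun_compose_eq_apply[OF proj_idem])
  have PX: "proj E (X u) = X u" for u
    by (rule blinfun_compose_eq_apply[OF bounded_ops_left[OF X]])
  have D: "norm (D u) \<le> q * norm u" for u
  proof -
    define w where "w = proj E u"
    have Pw: "proj E w = w" by (simp add: w_def P)
    have "norm (X (X' w)) \<le> C * norm (X' w)"
      using norm_blinfun[of X "X' w"] mult_right_mono[OF C(2) norm_ge_zero[of "X' w"]] by linarith
    then have "(norm (X (X' w)))\<^sup>2 \<le> (C * norm (X' w))\<^sup>2" by (intro power_mono) auto
    then have "t\<^sup>2 * (norm (X (X' w)))\<^sup>2 \<le> t\<^sup>2 * (C * norm (X' w))\<^sup>2"
      by (intro mult_left_mono) auto
    also have "\<dots> = t * (t * C\<^sup>2) * (norm (X' w))\<^sup>2" by (simp add: power2_eq_square algebra_simps)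
    finally have 1: "t\<^sup>2 * (norm (X (X' w)))\<^sup>2 \<le> t * (norm (X' w))\<^sup>2" by (simp add: t)
    have "(c * norm w)\<^sup>2 \<le> (norm (X' w))\<^sup>2" using c(1) c(2)[OF Pw] by (intro power_mono) auto
    then have "t * (c * norm w)\<^sup>2 \<le> t * (norm (X' w))\<^sup>2" using t by simp
    then have 2: "t * c\<^sup>2 * (norm w)\<^sup>2 \<le> t * (norm (X' w))\<^sup>2" by (simp add: power_mult_distrib)
    have 3: "inner w (X (X' w)) = (norm (X' w))\<^sup>2"
      using adj by (metis formal_adjoint_def inner_commute power2_norm_eq_inner)
    have "D u = w - t *\<^sub>R X (X' w)" by (simp add: D_def w_def blinfun.diff_left blinfun.scaleR_left)
    then have "(norm (D u))\<^sup>2 = (norm (w - t *\<^sub>R X (X' w)))\<^sup>2" by simp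
    also have "\<dots> = (norm w)\<^sup>2 - 2 * t * inner w (X (X' w)) + t\<^sup>2 * (norm (X (X' w)))\<^sup>2"
      unfolding power2_norm_eq_inner
      by (simp add: inner_diff inner_commute[of "X (X' w)" w] power2_eq_square algebra_simps)
    also have "\<dots> = (norm w)\<^sup>2 - 2 * t * (norm (X' w))\<^sup>2 + t\<^sup>2 * (norm (X (X' w)))\<^sup>2"
      by (simp only: 3)
    also have "\<dots> \<le> (norm w)\<^sup>2 - t * c\<^sup>2 * (norm w)\<^sup>2" using 1 2 by linarith
    also have "\<dots> = (q * norm w)\<^sup>2" by (simp add: power_mult_distrib q left_diff_distrib)
    finally have "norm (D u) \<le> q * norm w" 
      by (rule power2_le_imp_le) (use q(1) in simp)
    also have "\<dots> \<le> q * norm u" using q norm_proj_apply_le by (intro mult_left_mono) (auto simp: w_def)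
    finally show ?thesis .
  qed
  have "\<exists>!f. D f + t *\<^sub>R g = f"
  proof (rule banach_fix_type[OF q(1,2)], intro allI)
    fix x y
    show "dist (D x + t *\<^sub>R g) (D y + t *\<^sub>R g) \<le> q * dist x y"
      using D[of "x - y"] by (simp add: dist_norm blinfun.diff_right)
  qed
  then obtain f where f: "D f + t *\<^sub>R g = f" by blast
  have "proj E (D f + t *\<^sub>R g) = D f + t *\<^sub>R g"
    by (simp add: D_def blinfun.diff_left blinfun.scaleR_left blinfun.diff_right blinfun.add_right
        blinfun.scaleR_right P PX g)
  then have Pf: "proj E f = f" by (simp only: f)
  have "f - t *\<^sub>R X (X' f) + t *\<^sub>R g = f"
    using f by (simp add: D_def blinfun.diff_left blinfun.scaleR_left Pf)
  then have "t *\<^sub>R X (X' f) = t *\<^sub>R g" by (auto simp: algebra_simps)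
  then have "X (X' f) = g" using t(1) by simp
  then have "X (proj E (X' f)) = g"
    using blinfun_compose_eq_apply[OF bounded_ops_right[OF X]] by metis
  then show ?thesis using P by blast
qed

text \<open>
  One lower bound gives injectivity and the continuity of the inverse, the other one surjectivity.
\<close>

lemma bounded_ops_unitI:
  assumes X: "X \<in> carrier (bounded_ops E)" and adj: "formal_adjoint X X'"
    and low: "bounded_below E X" "bounded_below E X'"
  shows "X \<in> Units (bounded_ops E)"
proof -
  obtain c where c: "c > 0" "\<And>u. proj E u = u \<Longrightarrow> c * norm u \<le> norm (X u)"
    using low unfolding bounded_below_def by blast
  have P: "proj E (proj E u) = proj E u" for u :: "'a ell2"
    by (rule blinfun_compose_eq_apply[OF proj_idem])
  have PX: "proj E (X u) = X u" for u
    by (rule blinfun_compose_eq_apply[OF bounded_ops_left[OF X]])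
  have XP: "X (proj E u) = X u" for u
    by (rule blinfun_compose_eq_apply[OF bounded_ops_right[OF X]])
  have cX: "X (cscale a u) = cscale a (X u)" for a u
    using bounded_ops_clinear[OF X] by (simp add: is_clinear_def)
  have cP: "proj E (cscale a u) = cscale a (proj E u)" for a and u :: "'a ell2"
    using is_clinear_proj[of E] by (simp add: is_clinear_def)
  have inj: "u = v" if "proj E u = u" "proj E v = v" "X u = X v" for u v
  proof -
    have "c * norm (u - v) \<le> 0"
      using c(2)[of "u - v"] that by (simp add: blinfun.diff_right)
    then show ?thesis using c(1) by (simp add: mult_le_0_iff)
  qed
  have "\<forall>g. \<exists>f. proj E f = f \<and> X f = proj E g"
    using surjective_if_adjoint_bounded_below[OF X adj low(2) P] by blast
  then obtain R where R: "\<And>g. proj E (R g) = R g" "\<And>g. X (R g) = proj E g" by metis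
  have "bounded_linear R"
  proof (rule bounded_linear_ell2I)
    show "R (f + g) = R f + R g" for f g
      by (rule inj) (simp_all add: R blinfun.add_right)
    show "R (cscale a f) = cscale a (R f)" for a f
      by (rule inj) (simp_all add: R cX cP)
    show "norm (R f) \<le> norm f * (norm (proj E :: 'a ell2 \<Rightarrow>\<^sub>L 'a ell2) / c)" for f
    proof -
      have "c * norm (R f) \<le> norm (proj E f)" using c(2)[OF R(1)] by (simp add: R)
      also have "\<dots> \<le> norm (proj E :: 'a ell2 \<Rightarrow>\<^sub>L 'a ell2) * norm f" by (rule norm_blinfun)
      finally show ?thesis using c(1) by (simp add: field_simps)
    qed
  qed
  then have RB: "blinfun_apply (Blinfun R) = R" by (rule bounded_linear_Blinfun_apply)
  have "Blinfun R \<in> carrier (bounded_ops E)"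
  proof (rule bounded_opsI)
    show "is_clinear (Blinfun R)" unfolding is_clinear_def RB
      by (intro allI, rule inj) (simp_all add: R cX cP)
    show "proj E o\<^sub>L Blinfun R = Blinfun R" by (rule blinfun_eqI) (simp add: RB R)
    show "Blinfun R o\<^sub>L proj E = Blinfun R"
    proof (rule blinfun_eqI)
      show "(Blinfun R o\<^sub>L proj E) u = Blinfun R u" for u
        unfolding blinfun_apply_blinfun_compose RB
        by (rule inj[OF R(1) R(1)]) (simp only: R P)
    qed
  qed
  moreover have "X o\<^sub>L Blinfun R = proj E" by (rule blinfun_eqI) (simp add: RB R)
  moreover have "Blinfun R o\<^sub>L X = proj E"
  proof (rule blinfun_eqI)
    show "(Blinfun R o\<^sub>L X) u = proj E u" for u
      unfolding blinfun_apply_blinfun_compose RB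
      by (rule inj[OF R(1) P]) (simp only: R PX XP)
  qed
  ultimately show ?thesis using X unfolding Units_def by auto
qed

lemma unit_bounded_below:
  assumes "X \<in> Units (bounded_ops E)"
  shows "bounded_below E X"
proof -
  obtain S where "S o\<^sub>L X = proj E" using assms unfolding Units_def by auto
  then have S: "S (X u) = proj E u" for u by (rule blinfun_compose_eq_apply)
  show ?thesis unfolding bounded_below_def
  proof (intro exI[of _ "1 / (norm S + 1)"] conjI allI impI)
    show "1 / (norm S + 1) > 0" by (simp add: add_nonneg_pos)
    fix u assume u: "proj E u = u"
    have "norm u \<le> norm S * norm (X u)" using norm_blinfun[of S "X u"] by (simp add: S u)
    also have "\<dots> \<le> norm (X u) * (norm S + 1)" by (simp add: algebra_simps)
    finally show "1 / (norm S + 1) * norm u \<le> norm (X u)"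
      using pos_divide_le_eq[of "norm S + 1" "norm u" "norm (X u)"] norm_ge_zero[of S] by simp
  qed
qed

text \<open>
  If \<open>X S = 1\<close> then \<open>\<parallel>u\<parallel>\<^sup>2 = \<langle>X S u, u\<rangle> = \<langle>S u, X' u\<rangle>\<close>, which transfers the bound from \<open>X\<close> to \<open>X'\<close> by
  the Cauchy-Schwarz inequality.
\<close>

lemma unit_adjoint_bounded_below:
  assumes X: "X \<in> Units (bounded_ops E)" and adj: "formal_adjoint X X'"
  shows "bounded_below E X'"
proof -
  obtain S where "X o\<^sub>L S = proj E" using X unfolding Units_def by auto
  then have S: "X (S u) = proj E u" for u by (rule blinfun_compose_eq_apply)
  show ?thesis unfolding bounded_below_def
  proof (intro exI[of _ "1 / (norm S + 1)"] conjI allI impI)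
    show "1 / (norm S + 1) > 0" by (simp add: add_nonneg_pos)
    fix u assume u: "proj E u = u"
    have "norm u * norm u = inner (S u) (X' u)"
      using adj u by (metis S formal_adjoint_def power2_eq_square power2_norm_eq_inner)
    also have "\<dots> \<le> norm (S u) * norm (X' u)" by (rule norm_cauchy_schwarz)
    also have "\<dots> \<le> (norm S * norm u) * norm (X' u)"
      by (intro mult_right_mono norm_blinfun) auto
    finally have "norm u * norm u \<le> norm u * (norm S * norm (X' u))" by (simp add: algebra_simps)
    then have "norm u \<le> norm S * norm (X' u)"
      by (cases "norm u = 0") (auto simp: mult_le_cancel_left_pos)
    also have "\<dots> \<le> norm (X' u) * (norm S + 1)" by (simp add: algebra_simps)
    finally show "1 / (norm S + 1) * norm u \<le> norm (X' u)"
      using pos_divide_le_eq[of "norm S + 1" "norm u" "norm (X' u)"] norm_ge_zero[of S] by simp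
  qed
qed

lemma bounded_ops_a_minus:
  assumes "A \<in> carrier (bounded_ops E)" "B \<in> carrier (bounded_ops E)"
  shows "A \<ominus>\<^bsub>bounded_ops E\<^esub> B = A - B"
proof -
  interpret ring "bounded_ops E" by (rule ring_bounded_ops)
  have "\<ominus>\<^bsub>bounded_ops E\<^esub> B = - B"
    using assms by (intro minus_equality) (auto simp: bounded_ops_uminus)
  then show ?thesis by (simp add: a_minus_def)
qed

lemma bounded_ops_diff:
  assumes "A \<in> carrier (bounded_ops E)" "B \<in> carrier (bounded_ops E)"
  shows "A - B \<in> carrier (bounded_ops E)"
  using bounded_ops_add[OF assms(1) bounded_ops_uminus[OF assms(2)]] by simp

lemma bounded_ops_cscale:
  assumes "A \<in> carrier (bounded_ops E)"
  shows "cscale_op c o\<^sub>L A \<in> carrier (bounded_ops E)"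
proof (rule bounded_opsI)
  show "is_clinear (cscale_op c o\<^sub>L A)" using bounded_ops_clinear[OF assms]
    by (simp add: is_clinear_def cscale_op.rep_eq)
      (intro allI ell2_eqI, simp add: cscale.rep_eq)
  have "proj E o\<^sub>L (cscale_op c o\<^sub>L A) = cscale_op c o\<^sub>L (proj E o\<^sub>L A)"
    by (intro blinfun_eqI ell2_eqI) (simp add: proj_apply cscale_op.rep_eq cscale.rep_eq)
  then show "proj E o\<^sub>L (cscale_op c o\<^sub>L A) = cscale_op c o\<^sub>L A"
    by (simp only: bounded_ops_left[OF assms])
  show "cscale_op c o\<^sub>L A o\<^sub>L proj E = cscale_op c o\<^sub>L A"
    by (simp only: blinfun_compose_assoc bounded_ops_right[OF assms])
qed

lemmas bounded_ops_cscale_proj = bounded_ops_cscale[OF bounded_ops_proj]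

lemma spectrum_iff:
  assumes "A \<in> carrier (bounded_ops E)"
  shows "z \<in> spectrum E A \<longleftrightarrow> A - (cscale_op z o\<^sub>L proj E) \<notin> Units (bounded_ops E)"
  unfolding spectrum_def algebra_spectrum_def
  by (simp add: bounded_ops_a_minus[OF assms bounded_ops_cscale_proj])

lemma ess_spectrum_iff:
  assumes A: "A \<in> carrier (bounded_ops E)"
  shows "z \<in> ess_spectrum E A \<longleftrightarrow>
    to_calkin E (A - (cscale_op z o\<^sub>L proj E)) \<notin> Units (calkin E)"
proof -
  interpret R: ring_hom_ring "bounded_ops E" "calkin E" "to_calkin E"
    unfolding calkin_def to_calkin_def[abs_def]
    by (rule ideal.rcos_ring_hom_ring[OF ideal_compact_ops])
  have "to_calkin E A \<ominus>\<^bsub>calkin E\<^esub> to_calkin E (cscale_op z o\<^sub>L proj E)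
      = to_calkin E (A \<ominus>\<^bsub>bounded_ops E\<^esub> (cscale_op z o\<^sub>L proj E))"
    unfolding a_minus_def
    by (simp add: A bounded_ops_cscale_proj R.hom_add R.hom_a_inv R.R.a_inv_closed del: bounded_ops_simps)
  then show ?thesis unfolding ess_spectrum_def algebra_spectrum_def
    by (simp add: bounded_ops_a_minus[OF A bounded_ops_cscale_proj])
qed

lemma ess_spectrum_subset_spectrum:
  assumes A: "A \<in> carrier (bounded_ops E)"
  shows "ess_spectrum E A \<subseteq> spectrum E A"
proof -
  interpret R: ring_hom_ring "bounded_ops E" "calkin E" "to_calkin E"
    unfolding calkin_def to_calkin_def[abs_def]
    by (rule ideal.rcos_ring_hom_ring[OF ideal_compact_ops])
  have "to_calkin E X \<in> Units (calkin E)" if X: "X \<in> Units (bounded_ops E)" for X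
  proof -
    obtain S where S: "S \<in> carrier (bounded_ops E)" "X \<in> carrier (bounded_ops E)"
      "S \<otimes>\<^bsub>bounded_ops E\<^esub> X = \<one>\<^bsub>bounded_ops E\<^esub>" "X \<otimes>\<^bsub>bounded_ops E\<^esub> S = \<one>\<^bsub>bounded_ops E\<^esub>"
      using X unfolding Units_def by blast
    have "to_calkin E S \<otimes>\<^bsub>calkin E\<^esub> to_calkin E X = \<one>\<^bsub>calkin E\<^esub>"
      "to_calkin E X \<otimes>\<^bsub>calkin E\<^esub> to_calkin E S = \<one>\<^bsub>calkin E\<^esub>"
      using S by (metis R.hom_mult R.hom_one)+
    then show ?thesis using S unfolding Units_def by auto
  qed
  then show ?thesis by (auto simp: spectrum_iff[OF A] ess_spectrum_iff[OF A])
qed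

text \<open>
  Half of Atkinson's characterisation of the units of the Calkin algebra: a representative
  of the inverse coset is an inverse up to compact operators.
\<close>

lemma calkin_unit_obtain:
  assumes X: "X \<in> carrier (bounded_ops E)" and u: "to_calkin E X \<in> Units (calkin E)"
  obtains S where "S \<in> carrier (bounded_ops E)"
    "(S o\<^sub>L X) - proj E \<in> compact_ops E" "(X o\<^sub>L S) - proj E \<in> compact_ops E"
proof -
  interpret I: ideal "compact_ops E" "bounded_ops E" by (rule ideal_compact_ops)
  interpret R: ring_hom_ring "bounded_ops E" "calkin E" "to_calkin E"
    unfolding calkin_def to_calkin_def[abs_def] by (rule I.rcos_ring_hom_ring)
  obtain s where s: "s \<in> carrier (calkin E)" "s \<otimes>\<^bsub>calkin E\<^esub> to_calkin E X = \<one>\<^bsub>calkin E\<^esub>"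
    "to_calkin E X \<otimes>\<^bsub>calkin E\<^esub> s = \<one>\<^bsub>calkin E\<^esub>"
    using u unfolding Units_def by blast
  have "carrier (calkin E) = to_calkin E ` carrier (bounded_ops E)"
    unfolding calkin_def FactRing_def A_RCOSETS_def' to_calkin_def[abs_def] by auto
  then obtain S where S: "S \<in> carrier (bounded_ops E)" "s = to_calkin E S"
    using s(1) by blast
  have *: "A - proj E \<in> compact_ops E"
    if A: "A \<in> carrier (bounded_ops E)" "to_calkin E A = \<one>\<^bsub>calkin E\<^esub>" for A
  proof -
    have "to_calkin E A = to_calkin E (proj E)" using A(2) R.hom_one by simp
    then have "A \<ominus>\<^bsub>bounded_ops E\<^esub> proj E \<in> compact_ops E"
      using A(1) bounded_ops_proj unfolding to_calkin_def
      by (subst ring.quotient_eq_iff_same_a_r_cos[OF ring_bounded_ops ideal_compact_ops]) auto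
    then show ?thesis by (simp add: bounded_ops_a_minus[OF A(1) bounded_ops_proj])
  qed
  show ?thesis
  proof (rule that[OF S(1)])
    show "(S o\<^sub>L X) - proj E \<in> compact_ops E"
      using s S X R.hom_mult[of S X] by (intro * bounded_ops_mult) auto
    show "(X o\<^sub>L S) - proj E \<in> compact_ops E"
      using s S X R.hom_mult[of X S] by (intro * bounded_ops_mult) auto
  qed
qed

section \<open>Norm convergent sums of operators\<close>

lemma cinner_cscale_left: "cinner (cscale c f) g = cnj c * cinner f g"
  unfolding cinner_def cscale.rep_eq
  by (subst infsum_cmult_right'[symmetric]) (simp add: mult.assoc)

lemma cinner_cscale_right: "cinner f (cscale c g) = c * cinner f g"
  unfolding cinner_def cscale.rep_eq
  by (subst infsum_cmult_right'[symmetric]) (simp add: mult.left_commute)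

lemma inner_cscale: "inner (cscale c f) g = inner f (cscale (cnj c) g)"
  by (simp add: inner_ell2_def cinner_cscale_left cinner_cscale_right)

lemma cinner_eq_inner: "cinner f g = Complex (inner f g) (inner (cscale \<i> f) g)"
  by (simp add: complex_eq_iff inner_ell2_def cinner_cscale_left)

lemma is_clinearD: "is_clinear A \<Longrightarrow> A (cscale c f) = cscale c (A f)"
  by (simp add: is_clinear_def)

text \<open>
  Replacing \<open>f\<close> by \<open>i f\<close> recovers the imaginary part of the complex inner product, so a formal adjoint
  is the adjoint.
\<close>

lemma cadjoint_eqI:
  assumes "is_clinear B" "formal_adjoint B A"
  shows "cadjoint A = B"
  unfolding cadjoint_def
proof (rule the_equality)
  show "\<forall>f g. cinner (B f) g = cinner f (A g)"
    using assms(2) by (simp add: cinner_eq_inner is_clinearD[OF assms(1), symmetric] formal_adjoint_def)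
  fix B' assume *: "\<forall>f g. cinner (blinfun_apply B' f) g = cinner f (A g)"
  show "B' = B"
  proof (rule blinfun_eqI)
    fix f
    have "inner (B' f) g = inner (B f) g" for g
      using * assms(2) by (simp add: formal_adjoint_def inner_ell2_def)
    then show "B' f = B f" by (metis inner_left_distrib vector_eq_rdot)
  qed
qed

lemma cscale_cscale: "cscale a (cscale b f) = cscale (a * b) f"
  by transfer (simp add: mult.assoc)

lemma norm_cscale_op_le: "norm (cscale_op c :: 'a ell2 \<Rightarrow>\<^sub>L 'a ell2) \<le> cmod c"
  by (rule norm_blinfun_bound) (simp_all add: cscale_op.rep_eq norm_cscale)

lemma norm_cscale_op_compose_le: "norm (cscale_op c o\<^sub>L A) \<le> cmod c * norm A"
  using norm_blinfun_compose[of "cscale_op c" A] mult_right_mono[OF norm_cscale_op_le norm_ge_zero]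
  by (rule order_trans)

lemma formal_adjoint_proj: "formal_adjoint (proj E) (proj E)"
  unfolding formal_adjoint_def inner_ell2_eq proj_apply
  by (intro allI infsum_cong) simp

lemma formal_adjoint_cscale:
  assumes "formal_adjoint A B" "is_clinear B"
  shows "formal_adjoint (cscale_op c o\<^sub>L A) (cscale_op (cnj c) o\<^sub>L B)"
  using assms by (simp add: formal_adjoint_def cscale_op.rep_eq inner_cscale is_clinearD)

lemma formal_adjoint_add:
  "formal_adjoint A A' \<Longrightarrow> formal_adjoint B B' \<Longrightarrow> formal_adjoint (A + B) (A' + B')"
  by (simp add: formal_adjoint_def blinfun.add_left inner_add_left inner_add_right)

lemma formal_adjoint_diff:
  "formal_adjoint A A' \<Longrightarrow> formal_adjoint B B' \<Longrightarrow> formal_adjoint (A - B) (A' - B')"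
  by (simp add: formal_adjoint_def blinfun.diff_left inner_diff_left inner_diff_right)

definition weighted_sum :: "'i set \<Rightarrow> ('i \<Rightarrow> complex) \<Rightarrow> ('i \<Rightarrow> 'a ell2 \<Rightarrow>\<^sub>L 'a ell2) \<Rightarrow> 'a ell2 \<Rightarrow>\<^sub>L 'a ell2"
  where "weighted_sum I w C = (\<Sum>\<^sub>\<infinity>i\<in>I. cscale_op (w i) o\<^sub>L C i)"

context
  fixes I :: "'i set" and w :: "'i \<Rightarrow> complex" and C :: "'i \<Rightarrow> 'a ell2 \<Rightarrow>\<^sub>L 'a ell2"
  assumes w: "(\<lambda>i. cmod (w i)) summable_on I" and C: "\<And>i. i \<in> I \<Longrightarrow> norm (C i) \<le> 1"
begin

lemma weighted_term_norm: "i \<in> I \<Longrightarrow> norm (cscale_op (w i) o\<^sub>L C i) \<le> cmod (w i)"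
  using norm_cscale_op_compose_le[of "w i" "C i"] mult_left_le[OF C, of i "cmod (w i)"] by simp

lemma weighted_abs_summable: "(\<lambda>i. norm (cscale_op (w i) o\<^sub>L C i)) summable_on I"
  by (rule Infinite_Sum.abs_summable_on_comparison_test[OF w]) (simp add: weighted_term_norm)

lemma weighted_summable: "(\<lambda>i. cscale_op (w i) o\<^sub>L C i) summable_on I"
  by (rule abs_summable_summable[OF weighted_abs_summable])

text \<open>
  This controls the error of truncation by the weights alone, hence uniformly over all families of
  contractions and over all phases of the weights.
\<close>

lemma weighted_sum_tail:
  assumes "finite F" "F \<subseteq> I"
  shows "norm (weighted_sum I w C - (\<Sum>i\<in>F. cscale_op (w i) o\<^sub>L C i))
    \<le> (\<Sum>\<^sub>\<infinity>i\<in>I. cmod (w i)) - (\<Sum>i\<in>F. cmod (w i))"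
proof -
  have wd: "(\<lambda>i. cmod (w i)) summable_on I - F" by (rule summable_on_subset_banach[OF w]) auto
  have sd: "(\<lambda>i. norm (cscale_op (w i) o\<^sub>L C i)) summable_on I - F"
    by (rule summable_on_subset_banach[OF weighted_abs_summable]) auto
  have "weighted_sum I w C - (\<Sum>i\<in>F. cscale_op (w i) o\<^sub>L C i)
      = (\<Sum>\<^sub>\<infinity>i\<in>I - F. cscale_op (w i) o\<^sub>L C i)"
    unfolding weighted_sum_def
    using infsum_Diff[OF weighted_summable summable_on_finite[OF assms(1)] assms(2)] assms(1) by simp
  then have "norm (weighted_sum I w C - (\<Sum>i\<in>F. cscale_op (w i) o\<^sub>L C i))
      \<le> (\<Sum>\<^sub>\<infinity>i\<in>I - F. norm (cscale_op (w i) o\<^sub>L C i))"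
    using norm_infsum_bound[OF sd] by simp
  also have "\<dots> \<le> (\<Sum>\<^sub>\<infinity>i\<in>I - F. cmod (w i))"
    by (rule infsum_mono[OF sd wd]) (use weighted_term_norm in auto)
  also have "\<dots> = (\<Sum>\<^sub>\<infinity>i\<in>I. cmod (w i)) - (\<Sum>i\<in>F. cmod (w i))"
    using infsum_Diff[OF w summable_on_finite[OF assms(1)] assms(2)] assms(1) by simp
  finally show ?thesis .
qed

lemma weighted_sum_compose_left: "A o\<^sub>L weighted_sum I w C = (\<Sum>\<^sub>\<infinity>i\<in>I. A o\<^sub>L (cscale_op (w i) o\<^sub>L C i))"
  unfolding weighted_sum_def
  using has_sum_bounded_linear[OF bounded_bilinear.bounded_linear_right[OF bounded_bilinear_blinfun_compose]
      has_sum_infsum[OF weighted_summable]]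
  by (rule infsumI[symmetric])

lemma weighted_sum_compose_right: "weighted_sum I w C o\<^sub>L A = (\<Sum>\<^sub>\<infinity>i\<in>I. cscale_op (w i) o\<^sub>L C i o\<^sub>L A)"
  unfolding weighted_sum_def
  using has_sum_bounded_linear[OF bounded_bilinear.bounded_linear_left[OF bounded_bilinear_blinfun_compose]
      has_sum_infsum[OF weighted_summable]]
  by (rule infsumI[symmetric])

lemma weighted_sum_carrier:
  assumes "\<And>i. i \<in> I \<Longrightarrow> C i \<in> carrier (bounded_ops E)"
  shows "weighted_sum I w C \<in> carrier (bounded_ops E)"
proof (rule bounded_opsI)
  have c: "cscale_op (w i) o\<^sub>L C i \<in> carrier (bounded_ops E)" if "i \<in> I" for i
    by (rule bounded_ops_cscale[OF assms[OF that]])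
  show "proj E o\<^sub>L weighted_sum I w C = weighted_sum I w C"
    unfolding weighted_sum_compose_left
    by (simp add: weighted_sum_def bounded_ops_left[OF c] cong: infsum_cong)
  show "weighted_sum I w C o\<^sub>L proj E = weighted_sum I w C"
    unfolding weighted_sum_compose_right
    by (simp add: weighted_sum_def bounded_ops_right[OF c] cong: infsum_cong)
  have "cscale_op a o\<^sub>L weighted_sum I w C = weighted_sum I w C o\<^sub>L cscale_op a" for a
    unfolding weighted_sum_compose_left weighted_sum_compose_right
    by (intro infsum_cong blinfun_eqI)
       (simp add: cscale_op.rep_eq is_clinearD[OF bounded_ops_clinear[OF assms]]
          cscale_cscale mult.commute)
  then show "is_clinear (weighted_sum I w C)"
    by (metis blinfun_apply_blinfun_compose cscale_op.rep_eq is_clinear_def)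
qed

end

lemma weighted_sum_inner:
  assumes "(\<lambda>i. cmod (w i)) summable_on I" "\<And>i. i \<in> I \<Longrightarrow> norm (C i) \<le> 1"
  shows "inner (weighted_sum I w C u) v = (\<Sum>\<^sub>\<infinity>i\<in>I. inner ((cscale_op (w i) o\<^sub>L C i) u) v)"
  unfolding weighted_sum_def
  using has_sum_bounded_linear[OF bounded_linear_compose[OF bounded_linear_inner_left
        bounded_bilinear.bounded_linear_left[OF bounded_bilinear_blinfun_apply]]
      has_sum_infsum[OF weighted_summable[OF assms]]]
  by (rule infsumI[symmetric])

lemma weighted_sum_adjoint:
  assumes w: "(\<lambda>i. cmod (w i)) summable_on I"
    and C: "\<And>i. i \<in> I \<Longrightarrow> norm (C i) \<le> 1"
    and C': "\<And>i. i \<in> I \<Longrightarrow> norm (C' i) \<le> 1" "\<And>i. i \<in> I \<Longrightarrow> is_clinear (C' i)"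
    and adj: "\<And>i. i \<in> I \<Longrightarrow> formal_adjoint (C i) (C' i)"
  shows "formal_adjoint (weighted_sum I w C) (weighted_sum I (\<lambda>i. cnj (w i)) C')"
  unfolding formal_adjoint_def
proof (intro allI)
  fix u v
  have w': "(\<lambda>i. cmod (cnj (w i))) summable_on I" using w by simp
  have "inner (weighted_sum I w C u) v = (\<Sum>\<^sub>\<infinity>i\<in>I. inner ((cscale_op (w i) o\<^sub>L C i) u) v)"
    by (rule weighted_sum_inner[OF w C])
  also have "\<dots> = (\<Sum>\<^sub>\<infinity>i\<in>I. inner ((cscale_op (cnj (w i)) o\<^sub>L C' i) v) u)"
    using formal_adjoint_cscale[OF adj C'(2)]
    by (intro infsum_cong) (simp add: formal_adjoint_def inner_commute)
  also have "\<dots> = inner (weighted_sum I (\<lambda>i. cnj (w i)) C' v) u"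
    by (rule weighted_sum_inner[OF w' C'(1), symmetric])
  finally show "inner (weighted_sum I w C u) v = inner u (weighted_sum I (\<lambda>i. cnj (w i)) C' v)"
    by (simp only: inner_commute)
qed

lemma weighted_sum_reindex:
  assumes "bij_betw h J I"
  shows "weighted_sum I w C = weighted_sum J (\<lambda>j. w (h j)) (\<lambda>j. C (h j))"
  unfolding weighted_sum_def by (rule infsum_reindex_bij_betw[OF assms, symmetric])

section \<open>Compressed translations and Toeplitz operators\<close>

abbreviation sub :: "int list \<Rightarrow> int list \<Rightarrow> int list" where "sub \<equiv> map2 (-)"
abbreviation neg :: "int list \<Rightarrow> int list" where "neg \<equiv> map uminus"

lemma neg_Zpow: "x \<in> Zpow k \<Longrightarrow> neg x \<in> Zpow k"
  by (simp add: Zpow_def)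

lemma bij_neg: "bij_betw neg (Zpow k) (Zpow k)"
  by (rule bij_betwI[of _ _ _ neg]) (auto simp: neg_Zpow o_def)

lemma sub_sub_neg: "x \<in> Zpow k \<Longrightarrow> y \<in> Zpow k \<Longrightarrow> sub (sub x y) (neg y) = x"
  by (rule nth_equalityI) (auto simp: Zpow_def)

lemma sub_neg_sub: "x \<in> Zpow k \<Longrightarrow> y \<in> Zpow k \<Longrightarrow> sub (sub x (neg y)) y = x"
  by (rule nth_equalityI) (auto simp: Zpow_def)

context
  fixes k :: nat and E :: "int list set" and \<eta> :: "int list"
  assumes E: "E \<subseteq> Zpow k" and \<eta>: "\<eta> \<in> Zpow k"
begin

lemma compressed_translate_apply:
  "ell2_nth (compressed_translate E \<eta> f) x = (if x \<in> E \<and> sub x \<eta> \<in> E then ell2_nth f (sub x \<eta>) else 0)"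
  using E \<eta> by (auto simp: compressed_translate_def proj_apply translate.rep_eq
      ell2_translate.rep_eq Zpow_def)

lemma is_clinear_compressed_translate: "is_clinear (compressed_translate E \<eta>)"
  unfolding is_clinear_def
  by (intro allI ell2_eqI) (simp add: compressed_translate_apply cscale.rep_eq)

lemma compressed_translate_carrier: "compressed_translate E \<eta> \<in> carrier (bounded_ops E)"
  by (intro bounded_opsI is_clinear_compressed_translate blinfun_eqI ell2_eqI)
     (auto simp: compressed_translate_apply proj_apply)

lemma norm_compressed_translate_le: "norm (compressed_translate E \<eta>) \<le> 1"
proof (rule norm_blinfun_bound)
  have "norm (translate \<eta> u) \<le> norm u" for u
  proof (rule power2_le_imp_le)
    show "(norm (translate \<eta> u))\<^sup>2 \<le> (norm u)\<^sup>2"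
      unfolding norm_ell2_square translate.rep_eq ell2_translate.rep_eq
      by (rule translate_square_summable(2)[OF ell2_summable])
  qed simp
  then have "norm (translate \<eta>) \<le> 1" by (intro norm_blinfun_bound) auto
  show "norm (compressed_translate E \<eta> u) \<le> 1 * norm u" for u
  proof -
    have "norm (compressed_translate E \<eta> u) \<le> norm (translate \<eta> (proj E u))"
      unfolding compressed_translate_def by (simp add: norm_proj_apply_le)
    also have "\<dots> \<le> norm (proj E u)" by fact
    also have "\<dots> \<le> norm u" by (rule norm_proj_apply_le)
    finally show ?thesis by simp
  qed
qed simp

end

lemma formal_adjoint_compressed_translate:
  assumes E: "E \<subseteq> Zpow k" and \<eta>: "\<eta> \<in> Zpow k"
  shows "formal_adjoint (compressed_translate E \<eta>) (compressed_translate E (neg \<eta>))"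
  unfolding formal_adjoint_def
proof (intro allI)
  fix u v :: "int list ell2"
  let ?S = "{x \<in> E. sub x \<eta> \<in> E}" and ?S' = "{y \<in> E. sub y (neg \<eta>) \<in> E}"
  have Z: "x \<in> Zpow k" if "x \<in> E" for x using E that by auto
  have bij: "bij_betw (\<lambda>x. sub x \<eta>) ?S ?S'"
    by (rule bij_betwI[where g = "\<lambda>y. sub y (neg \<eta>)"])
       (auto simp: sub_sub_neg[OF Z \<eta>] sub_neg_sub[OF Z \<eta>])
  have "inner (compressed_translate E \<eta> u) v
      = (\<Sum>\<^sub>\<infinity>x\<in>?S. Re (cnj (ell2_nth u (sub x \<eta>)) * ell2_nth v x))"
    unfolding inner_ell2_eq
    by (rule infsum_cong_neutral) (auto simp: compressed_translate_apply[OF E \<eta>])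
  also have "\<dots> = (\<Sum>\<^sub>\<infinity>x\<in>?S. Re (cnj (ell2_nth u (sub x \<eta>)) * ell2_nth v (sub (sub x \<eta>) (neg \<eta>))))"
    by (intro infsum_cong) (simp add: sub_sub_neg[OF Z \<eta>])
  also have "\<dots> = (\<Sum>\<^sub>\<infinity>y\<in>?S'. Re (cnj (ell2_nth u y) * ell2_nth v (sub y (neg \<eta>))))"
    by (rule infsum_reindex_bij_betw[OF bij])
  also have "\<dots> = inner u (compressed_translate E (neg \<eta>) v)"
    unfolding inner_ell2_eq
    by (rule infsum_cong_neutral) (auto simp: compressed_translate_apply[OF E neg_Zpow[OF \<eta>]])
  finally show "inner (compressed_translate E \<eta> u) v = inner u (compressed_translate E (neg \<eta>) v)" .
qed

text \<open>
  A compressed translation is a partial isometry, and the points on which its range lives are those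
  of \<open>E \<inter> (E + \<eta>)\<close>. This makes \<open>V\<close> a sum of multiplication operators.
\<close>

lemma compressed_translate_range_projection:
  assumes E: "E \<subseteq> Zpow k" and \<eta>: "\<eta> \<in> Zpow k"
  shows "compressed_translate E \<eta> o\<^sub>L cadjoint (compressed_translate E \<eta>) = proj {x \<in> E. sub x \<eta> \<in> E}"
proof -
  have 1: "cadjoint (compressed_translate E \<eta>) = compressed_translate E (neg \<eta>)"
    using formal_adjoint_compressed_translate[OF E neg_Zpow[OF \<eta>]]
    by (intro cadjoint_eqI is_clinear_compressed_translate[OF E neg_Zpow[OF \<eta>]]) (simp add: o_def)
  show ?thesis unfolding 1
  proof (intro blinfun_eqI ell2_eqI)
    fix f x
    show "ell2_nth ((compressed_translate E \<eta> o\<^sub>L compressed_translate E (neg \<eta>)) f) x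
        = ell2_nth (proj {x \<in> E. sub x \<eta> \<in> E} f) x"
      using E sub_sub_neg[of x k \<eta>] \<eta>
      by (auto simp: compressed_translate_apply[OF E \<eta>] compressed_translate_apply[OF E neg_Zpow[OF \<eta>]]
          proj_apply)
  qed
qed

definition toeplitz_op :: "nat \<Rightarrow> int list set \<Rightarrow> (int list \<Rightarrow> complex) \<Rightarrow> (int list \<Rightarrow> complex) \<Rightarrow>
    complex \<Rightarrow> int list ell2 \<Rightarrow>\<^sub>L int list ell2"
  where "toeplitz_op k E \<phi> \<psi> z = toeplitz_T k E \<phi> + toeplitz_V k E \<psi> - (cscale_op z o\<^sub>L proj E)"

definition overlap :: "int list set \<Rightarrow> int list \<Rightarrow> int list ell2 \<Rightarrow>\<^sub>L int list ell2"
  where "overlap E \<eta> = proj {x \<in> E. sub x \<eta> \<in> E}"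

lemma overlap_carrier: "overlap E \<eta> \<in> carrier (bounded_ops E)"
  unfolding overlap_def
  by (intro bounded_opsI is_clinear_proj blinfun_eqI ell2_eqI) (auto simp: proj_apply)

lemma toeplitz_T_weighted_sum: "toeplitz_T k E \<phi> = weighted_sum (Zpow k) \<phi> (compressed_translate E)"
  by (simp add: toeplitz_T_def weighted_sum_def)

lemma toeplitz_V_weighted_sum:
  assumes "E \<subseteq> Zpow k"
  shows "toeplitz_V k E \<psi> = weighted_sum (Zpow k) \<psi> (overlap E)"
  unfolding toeplitz_V_def weighted_sum_def overlap_def
  by (intro infsum_cong) (simp only: compressed_translate_range_projection[OF assms])

lemma toeplitz_sum_carrier:
  assumes E: "E \<subseteq> Zpow k" and \<phi>: "(\<lambda>x. cmod (\<phi> x)) summable_on Zpow k"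
    and \<psi>: "(\<lambda>x. cmod (\<psi> x)) summable_on Zpow k"
  shows "toeplitz_T k E \<phi> + toeplitz_V k E \<psi> \<in> carrier (bounded_ops E)"
  unfolding toeplitz_T_weighted_sum toeplitz_V_weighted_sum[OF E]
  by (intro bounded_ops_add weighted_sum_carrier \<phi> \<psi> compressed_translate_carrier[OF E] overlap_carrier
      norm_compressed_translate_le[OF E]) (simp_all add: overlap_def norm_proj_le)

lemma toeplitz_op_carrier:
  assumes "E \<subseteq> Zpow k" "(\<lambda>x. cmod (\<phi> x)) summable_on Zpow k" "(\<lambda>x. cmod (\<psi> x)) summable_on Zpow k"
  shows "toeplitz_op k E \<phi> \<psi> z \<in> carrier (bounded_ops E)"
  unfolding toeplitz_op_def
  by (intro bounded_ops_diff toeplitz_sum_carrier assms bounded_ops_cscale_proj)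

text \<open>
  The adjoint of the compressed translation by \<open>\<eta>\<close> is the one by \<open>- \<eta>\<close>, so the reflection in the
  weights comes from reindexing the sum. The terms of \<open>V\<close> are self-adjoint.
\<close>

lemma toeplitz_op_adjoint:
  assumes E: "E \<subseteq> Zpow k" and \<phi>: "(\<lambda>x. cmod (\<phi> x)) summable_on Zpow k"
    and \<psi>: "(\<lambda>x. cmod (\<psi> x)) summable_on Zpow k"
  shows "formal_adjoint (toeplitz_op k E \<phi> \<psi> z)
    (toeplitz_op k E (\<lambda>x. cnj (\<phi> (neg x))) (\<lambda>x. cnj (\<psi> x)) (cnj z))"
proof -
  have "toeplitz_T k E (\<lambda>x. cnj (\<phi> (neg x)))
      = weighted_sum (Zpow k) (\<lambda>x. cnj (\<phi> x)) (\<lambda>x. compressed_translate E (neg x))"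
    unfolding toeplitz_T_weighted_sum by (subst weighted_sum_reindex[OF bij_neg]) (simp add: o_def)
  moreover have "formal_adjoint (weighted_sum (Zpow k) \<phi> (compressed_translate E))
      (weighted_sum (Zpow k) (\<lambda>x. cnj (\<phi> x)) (\<lambda>x. compressed_translate E (neg x)))"
    by (intro weighted_sum_adjoint \<phi> norm_compressed_translate_le[OF E] neg_Zpow
        is_clinear_compressed_translate[OF E] formal_adjoint_compressed_translate[OF E])
  moreover have "formal_adjoint (weighted_sum (Zpow k) \<psi> (overlap E))
      (weighted_sum (Zpow k) (\<lambda>x. cnj (\<psi> x)) (overlap E))"
    by (intro weighted_sum_adjoint \<psi>)
       (simp_all add: overlap_def norm_proj_le is_clinear_proj formal_adjoint_proj)
  ultimately show ?thesis
    unfolding toeplitz_op_def toeplitz_V_weighted_sum[OF E]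
    by (intro formal_adjoint_diff formal_adjoint_add formal_adjoint_cscale formal_adjoint_proj
        is_clinear_proj) (simp_all add: toeplitz_T_weighted_sum)
qed

section \<open>Slicing a cylinder along its axis\<close>

text \<open>
  Together with the first coordinate this inverts \<open>theta_inv\<close>.
\<close>

definition increments :: "int list \<Rightarrow> int list" where "increments x = sub (tl x) x"

lemma length_increments [simp]: "length (increments x) = length x - 1"
  by (simp add: increments_def)

lemma nth_increments: "Suc i < length x \<Longrightarrow> increments x ! i = x ! Suc i - x ! i"
  by (simp add: increments_def nth_tl)

lemma length_theta_inv [simp]: "length (theta_inv z) = length z"
  by (simp add: theta_inv_def)

lemma nth_theta_inv: "j < length z \<Longrightarrow> theta_inv z ! j = (\<Sum>i\<le>j. z ! i)"
  by (simp add: theta_inv_def)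

lemma theta_inv_neq_Nil [simp]: "theta_inv (k # y) \<noteq> []"
  by (metis length_theta_inv length_0_conv list.distinct(1))

lemma hd_theta_inv [simp]: "hd (theta_inv (k # y)) = k"
  by (simp add: hd_conv_nth nth_theta_inv)

lemma increments_theta_inv [simp]: "increments (theta_inv (k # y)) = y"
  by (rule nth_equalityI) (simp_all add: nth_increments nth_theta_inv)

lemma theta_inv_increments:
  assumes "x \<noteq> []"
  shows "theta_inv (hd x # increments x) = x"
proof (rule nth_equalityI)
  show "theta_inv (hd x # increments x) ! j = x ! j" if "j < length (theta_inv (hd x # increments x))" for j
    using that
  proof (induction j)
    case 0
    then show ?case using assms by (simp add: nth_theta_inv hd_conv_nth)
  next
    case (Suc j)
    then show ?case using assms by (simp add: nth_theta_inv nth_increments)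
  qed
qed (use assms in simp)

lemma increments_sub: "length x = length y \<Longrightarrow> increments (sub x y) = sub (increments x) (increments y)"
  by (rule nth_equalityI) (simp_all add: nth_increments)

lemma hd_sub: "x \<noteq> [] \<Longrightarrow> y \<noteq> [] \<Longrightarrow> hd (sub x y) = hd x - hd y"
  by (cases x; cases y) auto

lemma sub_theta_inv:
  assumes "y \<in> Zpow n" "\<eta> \<in> Zpow (Suc n)"
  shows "sub (theta_inv (k # y)) \<eta> = theta_inv ((k - hd \<eta>) # sub y (increments \<eta>))"
proof -
  have l: "length (theta_inv (k # y)) = length \<eta>" "\<eta> \<noteq> []" using assms by (auto simp: Zpow_def)
  then have "sub (theta_inv (k # y)) \<eta> \<noteq> []" by (simp flip: length_0_conv)
  from theta_inv_increments[OF this] show ?thesis using l by (simp add: increments_sub hd_sub)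
qed

text \<open>
  For \<open>u\<close> on \<open>\<int>\<^sup>N\<close>, read as \<open>\<int> \<times> \<int>\<^sup>N\<^sup>-\<^sup>1\<close> by means of \<open>theta_inv\<close>, the slice at height \<open>k\<close> is \<open>u(k, \<cdot>)\<close>. In the
  other direction, \<open>emb\<close> places a function at height \<open>k\<close>.
\<close>

lift_definition slice :: "int \<Rightarrow> int list ell2 \<Rightarrow> int list ell2" is "\<lambda>k f y. f (theta_inv (k # y))"
proof -
  fix k :: int and f :: "int list \<Rightarrow> complex"
  let ?h = "\<lambda>y. theta_inv (k # y)"
  assume "(\<lambda>x. (cmod (f x))\<^sup>2) summable_on UNIV"
  then have "(\<lambda>x. (cmod (f x))\<^sup>2) summable_on range ?h" by (rule summable_on_subset_banach) simp
  moreover have "inj ?h" by (rule inj_on_inverseI[of _ increments]) simp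
  ultimately show "(\<lambda>y. (cmod (f (?h y)))\<^sup>2) summable_on UNIV"
    by (simp add: summable_on_reindex o_def)
qed

lift_definition emb :: "int \<Rightarrow> int list ell2 \<Rightarrow> int list ell2"
  is "\<lambda>k g x. if x \<noteq> [] \<and> hd x = k then g (increments x) else 0"
proof -
  fix k :: int and g :: "int list \<Rightarrow> complex"
  let ?S = "{x. x \<noteq> [] \<and> hd x = k}"
  assume "(\<lambda>x. (cmod (g x))\<^sup>2) summable_on UNIV"
  then have "(\<lambda>x. (cmod (g x))\<^sup>2) summable_on increments ` ?S" by (rule summable_on_subset_banach) simp
  moreover have "inj_on increments ?S"
    by (rule inj_on_inverseI[of _ "\<lambda>y. theta_inv (k # y)"]) (auto simp: theta_inv_increments)
  ultimately have "(\<lambda>x. (cmod (g (increments x)))\<^sup>2) summable_on ?S"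
    by (simp add: summable_on_reindex o_def)
  moreover have "(\<lambda>x. (cmod (g (increments x)))\<^sup>2) summable_on ?S \<longleftrightarrow>
      (\<lambda>x. (cmod (if x \<noteq> [] \<and> hd x = k then g (increments x) else 0))\<^sup>2) summable_on UNIV"
    by (rule summable_on_cong_neutral) auto
  ultimately show "(\<lambda>x. (cmod (if x \<noteq> [] \<and> hd x = k then g (increments x) else 0))\<^sup>2) summable_on UNIV"
    by simp
qed

lemma slice_add: "slice k (u + v) = slice k u + slice k v"
  by transfer simp
lemma slice_diff: "slice k (u - v) = slice k u - slice k v"
  by transfer simp
lemma slice_zero: "slice k 0 = 0"
  by transfer simp
lemma slice_cscale: "slice k (cscale c u) = cscale c (slice k u)"
  by transfer simp
lemma slice_sum: "slice k (sum f A) = (\<Sum>i\<in>A. slice k (f i))"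
  by (induction A rule: infinite_finite_induct) (simp_all add: slice_zero slice_add)
lemma slice_emb: "slice j (emb k g) = (if j = k then g else 0)"
  by transfer (auto simp: fun_eq_iff)

text \<open>
  The preimage of \<open>\<int> \<times> F\<close> in the original coordinates; the empty list has no first coordinate.
\<close>

definition cyl :: "int list set \<Rightarrow> int list set"
  where "cyl F = {x. x \<noteq> [] \<and> increments x \<in> F}"

lemma slice_proj: "slice k (proj (cyl F) u) = proj F (slice k u)"
  by (rule ell2_eqI) (simp add: slice.rep_eq proj_apply cyl_def)

text \<open>
  The slices see every value of \<open>u\<close> except the one at the empty list, hence the last hypothesis.
\<close>

lemma norm_square_slices:
  assumes K: "finite K" "\<And>k. k \<notin> K \<Longrightarrow> slice k u = 0" and u: "ell2_nth u [] = 0"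
  shows "(norm u)\<^sup>2 = (\<Sum>k\<in>K. (norm (slice k u))\<^sup>2)"
proof -
  let ?S = "{x. x \<noteq> [] \<and> hd x \<in> K}" and ?h = "\<lambda>(k, y). theta_inv (k # y)"
  have z: "ell2_nth u x = 0" if "x \<notin> ?S" for x
  proof (cases "x = []")
    case False
    then have "ell2_nth (slice (hd x) u) (increments x) = 0" using that K(2)[of "hd x"]
      by (simp add: zero_ell2.rep_eq)
    then show ?thesis using False by (simp add: slice.rep_eq theta_inv_increments)
  qed (simp add: u)
  have bij: "bij_betw ?h (K \<times> UNIV) ?S"
    by (rule bij_betwI[of _ _ _ "\<lambda>x. (hd x, increments x)"]) (auto simp: theta_inv_increments)
  have s: "(\<lambda>x. (cmod (ell2_nth u x))\<^sup>2) summable_on ?S"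
    by (rule summable_on_subset_banach[OF ell2_summable]) simp
  have s': "(\<lambda>(k, y). (cmod (ell2_nth u (theta_inv (k # y))))\<^sup>2) summable_on K \<times> UNIV"
    using s summable_on_reindex_bij_betw[OF bij, of "\<lambda>x. (cmod (ell2_nth u x))\<^sup>2"]
    by (simp add: case_prod_unfold)
  have "(norm u)\<^sup>2 = (\<Sum>\<^sub>\<infinity>x\<in>?S. (cmod (ell2_nth u x))\<^sup>2)"
    unfolding norm_ell2_square by (rule infsum_cong_neutral) (use z in auto)
  also have "\<dots> = (\<Sum>\<^sub>\<infinity>p\<in>K \<times> UNIV. (cmod (ell2_nth u (?h p)))\<^sup>2)"
    by (rule infsum_reindex_bij_betw[OF bij, symmetric])
  also have "\<dots> = (\<Sum>\<^sub>\<infinity>k\<in>K. \<Sum>\<^sub>\<infinity>y. (cmod (ell2_nth u (theta_inv (k # y))))\<^sup>2)"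
    using infsum_Sigma'_banach[OF s'] by (simp add: case_prod_unfold)
  also have "\<dots> = (\<Sum>k\<in>K. (norm (slice k u))\<^sup>2)"
    using K(1) by (simp add: norm_ell2_square slice.rep_eq)
  finally show ?thesis .
qed

section \<open>The Fourier transform along the axis\<close>

lemma has_integral_cis_int:
  "((\<lambda>t. Re (cis (2 * pi * of_int m * t) * w)) has_integral (if m = 0 then Re w else 0)) {0..1::real}"
proof (cases "m = 0")
  case True
  then show ?thesis using has_integral_const_real[of "Re w" 0 1] by simp
next
  case False
  let ?a = "2 * pi * of_int m"
  define G where "G t = sin (?a * t) / ?a * Re w + cos (?a * t) / ?a * Im w" for t :: real
  have a: "?a \<noteq> 0" using False by simp
  have "(G has_vector_derivative Re (cis (?a * t) * w)) (at t within {0..1})" for t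
    unfolding has_real_derivative_iff_has_vector_derivative[symmetric] G_def
    by (rule derivative_eq_intros refl a)+ (use False in \<open>simp add: field_simps\<close>)
  then have "((\<lambda>t. Re (cis (?a * t) * w)) has_integral G 1 - G 0) {0..1}"
    by (intro fundamental_theorem_of_calculus) auto
  moreover have "sin (?a * 1) = 0" "cos (?a * 1) = 1"
    using sin_int_2pin[of m] cos_int_2pin[of m] by simp_all
  ultimately show ?thesis using False by (simp add: G_def)
qed

text \<open>
  Expanding the square gives the characters \<open>exp (2 \<pi> i (k - l) t)\<close>, whose integrals over the period
  vanish off the diagonal.
\<close>

lemma parseval:
  assumes K: "finite K"
  shows "((\<lambda>t. (norm (\<Sum>k\<in>K. cscale (cis (- 2 * pi * of_int k * t)) (g k)))\<^sup>2) has_integral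
    (\<Sum>k\<in>K. (norm (g k))\<^sup>2)) {0..1::real}"
proof -
  have 1: "inner (cscale (cis (- 2 * pi * of_int k * t)) f) (cscale (cis (- 2 * pi * of_int l * t)) h)
      = Re (cis (2 * pi * of_int (k - l) * t) * cinner f h)" for k l t and f h :: "'a ell2"
  proof -
    have "cis (- 2 * pi * of_int l * t) * cnj (cis (- 2 * pi * of_int k * t))
        = cis (2 * pi * of_int (k - l) * t)"
      by (simp add: cis_cnj cis_mult algebra_simps)
    then show ?thesis
      unfolding inner_ell2_def cinner_cscale_left cinner_cscale_right by (metis mult.assoc)
  qed
  have 2: "(norm (\<Sum>k\<in>K. cscale (cis (- 2 * pi * of_int k * t)) (g k)))\<^sup>2
      = (\<Sum>k\<in>K. \<Sum>l\<in>K. Re (cis (2 * pi * of_int (k - l) * t) * cinner (g k) (g l)))" for t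
    unfolding power2_norm_eq_inner inner_sum_left
    unfolding inner_sum_right 1 ..
  have 3: "(\<Sum>l\<in>K. if k - l = 0 then Re (cinner (g k) (g l)) else 0) = (norm (g k))\<^sup>2" if "k \<in> K" for k
    using K that by (simp add: power2_norm_eq_inner inner_ell2_def)
  have "((\<lambda>t. \<Sum>k\<in>K. \<Sum>l\<in>K. Re (cis (2 * pi * of_int (k - l) * t) * cinner (g k) (g l))) has_integral
     (\<Sum>k\<in>K. \<Sum>l\<in>K. if k - l = 0 then Re (cinner (g k) (g l)) else 0)) {0..1}"
    by (intro has_integral_sum K has_integral_cis_int)
  then show ?thesis unfolding 2 by (simp only: 3 cong: sum.cong)
qed

definition finite_slices :: "int list ell2 \<Rightarrow> bool"
  where "finite_slices u \<longleftrightarrow> finite {k. slice k u \<noteq> 0}"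

text \<open>
  A finite sum for functions with finitely many nonzero slices, the only ones it is used for.
\<close>

definition fourier :: "int list ell2 \<Rightarrow> real \<Rightarrow> int list ell2"
  where "fourier u t = (\<Sum>k | slice k u \<noteq> 0. cscale (cis (- 2 * pi * of_int k * t)) (slice k u))"

lemma finite_slicesI: "finite K \<Longrightarrow> (\<And>k. k \<notin> K \<Longrightarrow> slice k u = 0) \<Longrightarrow> finite_slices u"
  unfolding finite_slices_def by (rule finite_subset) auto

lemma fourier_eq:
  assumes "finite K" "\<And>k. k \<notin> K \<Longrightarrow> slice k u = 0"
  shows "fourier u t = (\<Sum>k\<in>K. cscale (cis (- 2 * pi * of_int k * t)) (slice k u))"
  unfolding fourier_def using assms by (intro sum.mono_neutral_left) (auto simp: cscale_zero)

lemma fourier_parseval: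
  assumes "finite_slices u" "ell2_nth u [] = 0"
  shows "((\<lambda>t. (norm (fourier u t))\<^sup>2) has_integral (norm u)\<^sup>2) {0..1}"
proof -
  let ?K = "{k. slice k u \<noteq> 0}"
  have K: "finite ?K" using assms(1) by (simp only: finite_slices_def)
  have "(norm u)\<^sup>2 = (\<Sum>k\<in>?K. (norm (slice k u))\<^sup>2)"
    by (rule norm_square_slices[OF K _ assms(2)]) blast
  then show ?thesis using parseval[OF K, of "\<lambda>k. slice k u"] by (simp only: fourier_def)
qed

lemma fourier_in_range:
  assumes "proj (cyl F) u = u"
  shows "proj F (fourier u t) = fourier u t"
proof -
  have "proj F (slice k u) = slice k u" for k by (metis assms slice_proj)
  then show ?thesis unfolding fourier_def
    by (simp add: blinfun.sum_right is_clinearD[OF is_clinear_proj])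
qed

section \<open>Laurent operators and their symbols\<close>

text \<open>
  In the coordinates \<open>\<int> \<times> F\<close> this says \<open>X = S\<^sup>d \<otimes> Y\<close> with \<open>S\<close> the shift along \<open>\<int>\<close>.
\<close>

definition shifts :: "int list set \<Rightarrow> int \<Rightarrow> (int list ell2 \<Rightarrow>\<^sub>L int list ell2) \<Rightarrow>
    (int list ell2 \<Rightarrow>\<^sub>L int list ell2) \<Rightarrow> bool"
  where "shifts F d X Y \<longleftrightarrow> X \<in> carrier (bounded_ops (cyl F)) \<and> Y \<in> carrier (bounded_ops F) \<and>
    (\<forall>k u. slice k (X u) = Y (slice (k - d) u))"

text \<open>
  Finite sums \<open>\<Sum> S\<^sup>d \<otimes> Y\<close>, paired with their symbols \<open>\<Sum> exp (- 2 \<pi> i d t) Y\<close>. They preserve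
  functions with finitely many nonzero slices, so Fourier transforms can be computed as finite sums;
  the estimates then pass to the uniform limits of operator and symbol that are defined next.
\<close>

inductive laurent_poly :: "int list set \<Rightarrow> (int list ell2 \<Rightarrow>\<^sub>L int list ell2) \<Rightarrow>
    (real \<Rightarrow> int list ell2 \<Rightarrow>\<^sub>L int list ell2) \<Rightarrow> bool" for F
  where
    shift: "shifts F d X Y \<Longrightarrow> laurent_poly F X (\<lambda>t. cscale_op (cis (- 2 * pi * of_int d * t)) o\<^sub>L Y)"
  | add: "laurent_poly F X A \<Longrightarrow> laurent_poly F Y B \<Longrightarrow> laurent_poly F (X + Y) (\<lambda>t. A t + B t)"

definition laurent :: "int list set \<Rightarrow> (int list ell2 \<Rightarrow>\<^sub>L int list ell2) \<Rightarrow>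
    (real \<Rightarrow> int list ell2 \<Rightarrow>\<^sub>L int list ell2) \<Rightarrow> bool"
  where "laurent F X A \<longleftrightarrow>
    (\<forall>e>0. \<exists>Y B. laurent_poly F Y B \<and> norm (X - Y) \<le> e \<and> (\<forall>t. norm (A t - B t) \<le> e))"

lemma laurentE:
  assumes "laurent F X A" "0 < (e :: real)"
  obtains Y B where "laurent_poly F Y B" "norm (X - Y) \<le> e" "\<And>t. norm (A t - B t) \<le> e"
  using assms unfolding laurent_def by blast

lemma laurent_if_poly: "laurent_poly F X A \<Longrightarrow> laurent F X A"
  unfolding laurent_def by (metis diff_self less_imp_le norm_zero)

lemma laurent_add:
  assumes "laurent F X A" "laurent F Y B"
  shows "laurent F (X + Y) (\<lambda>t. A t + B t)"
  unfolding laurent_def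
proof (intro allI impI)
  fix e :: real assume e: "0 < e"
  obtain X' A' where 1: "laurent_poly F X' A'" "norm (X - X') \<le> e / 2" "\<And>t. norm (A t - A' t) \<le> e / 2"
    using laurentE[OF assms(1), of "e / 2"] e by auto
  obtain Y' B' where 2: "laurent_poly F Y' B'" "norm (Y - Y') \<le> e / 2" "\<And>t. norm (B t - B' t) \<le> e / 2"
    using laurentE[OF assms(2), of "e / 2"] e by auto
  have "norm (X + Y - (X' + Y')) \<le> e"
    using norm_diff_triangle_ineq[of X Y X' Y'] 1(2) 2(2) by linarith
  moreover have "norm (A t + B t - (A' t + B' t)) \<le> e" for t
    using norm_diff_triangle_ineq[of "A t" "B t" "A' t" "B' t"] 1(3)[of t] 2(3)[of t] by linarith
  ultimately show "\<exists>Y' B'. laurent_poly F Y' B' \<and> norm (X + Y - Y') \<le> e \<and> (\<forall>t. norm (A t + B t - B' t) \<le> e)"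
    using laurent_poly.add[OF 1(1) 2(1)] by blast
qed

lemma shifts_cscale:
  assumes "shifts F d X Y"
  shows "shifts F d (cscale_op c o\<^sub>L X) (cscale_op c o\<^sub>L Y)"
  using assms unfolding shifts_def
  by (simp add: bounded_ops_cscale cscale_op.rep_eq slice_cscale)

lemma shifts_zero: "shifts F 0 0 0"
  by (simp add: shifts_def bounded_ops_zero slice_zero)

text \<open>
  The same finite set of indices truncates the operator and, uniformly in \<open>t\<close>, its symbol, because the
  phases do not change the absolute values of the weights.
\<close>

lemma laurent_weighted_sum:
  assumes w: "(\<lambda>i. cmod (w i)) summable_on I"
    and C: "\<And>i. i \<in> I \<Longrightarrow> norm (C i) \<le> 1" "\<And>i. i \<in> I \<Longrightarrow> norm (C' i) \<le> 1"
    and sh: "\<And>i. i \<in> I \<Longrightarrow> shifts F (d i) (C i) (C' i)"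
  shows "laurent F (weighted_sum I w C)
    (\<lambda>t. weighted_sum I (\<lambda>i. w i * cis (- 2 * pi * of_int (d i) * t)) C')"
  unfolding laurent_def
proof (intro allI impI)
  fix e :: real assume e: "0 < e"
  have "((\<lambda>i. cmod (w i)) has_sum (\<Sum>\<^sub>\<infinity>i\<in>I. cmod (w i))) I" by (rule has_sum_infsum[OF w])
  then have "\<forall>\<^sub>F S in finite_subsets_at_top I. dist (\<Sum>i\<in>S. cmod (w i)) (\<Sum>\<^sub>\<infinity>i\<in>I. cmod (w i)) < e"
    unfolding has_sum_def using e by (rule tendstoD)
  then obtain S where S: "finite S" "S \<subseteq> I" "dist (\<Sum>i\<in>S. cmod (w i)) (\<Sum>\<^sub>\<infinity>i\<in>I. cmod (w i)) < e"
    unfolding eventually_finite_subsets_at_top by blast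
  define X where "X = (\<Sum>i\<in>S. cscale_op (w i) o\<^sub>L C i)"
  define A where "A t = (\<Sum>i\<in>S. cscale_op (w i * cis (- 2 * pi * of_int (d i) * t)) o\<^sub>L C' i)" for t :: real
  have w': "(\<lambda>i. cmod (w i * cis (- 2 * pi * of_int (d i) * t))) summable_on I" for t :: real
    using w by (simp add: norm_mult)
  have "norm (weighted_sum I w C - X) \<le> (\<Sum>\<^sub>\<infinity>i\<in>I. cmod (w i)) - (\<Sum>i\<in>S. cmod (w i))"
    unfolding X_def by (rule weighted_sum_tail[OF w _ S(1,2)]) (rule C(1))
  then have "norm (weighted_sum I w C - X) \<le> e" using S(3) unfolding dist_real_def by linarith
  moreover have "norm (weighted_sum I (\<lambda>i. w i * cis (- 2 * pi * of_int (d i) * t)) C' - A t) \<le> e" for t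
  proof -
    have "norm (weighted_sum I (\<lambda>i. w i * cis (- 2 * pi * of_int (d i) * t)) C' - A t)
        \<le> (\<Sum>\<^sub>\<infinity>i\<in>I. cmod (w i * cis (- 2 * pi * of_int (d i) * t)))
          - (\<Sum>i\<in>S. cmod (w i * cis (- 2 * pi * of_int (d i) * t)))"
      unfolding A_def by (rule weighted_sum_tail[OF w' _ S(1,2)]) (rule C(2))
    then show ?thesis using S(3) unfolding dist_real_def norm_mult norm_cis mult_1_right by linarith
  qed
  moreover have "laurent_poly F X A"
  proof -
    have "laurent_poly F (\<Sum>i\<in>S. cscale_op (w i) o\<^sub>L C i)
      (\<lambda>t. \<Sum>i\<in>S. cscale_op (w i * cis (- 2 * pi * of_int (d i) * t)) o\<^sub>L C' i)"
      using S(1,2)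
    proof (induction S rule: finite_induct)
      case empty
      have "cscale_op c o\<^sub>L 0 = (0 :: int list ell2 \<Rightarrow>\<^sub>L int list ell2)" for c
        by (rule blinfun_eqI) (simp add: cscale_op.rep_eq cscale_zero)
      then show ?case using laurent_poly.shift[OF shifts_zero, of F] by (simp only: sum.empty)
    next
      case (insert i S)
      have "cscale_op (w i * cis x) o\<^sub>L C' i = cscale_op (cis x) o\<^sub>L (cscale_op (w i) o\<^sub>L C' i)" for x
        by (rule blinfun_eqI) (simp add: cscale_op.rep_eq cscale_cscale mult.commute)
      then have "laurent_poly F (cscale_op (w i) o\<^sub>L C i)
          (\<lambda>t. cscale_op (w i * cis (- 2 * pi * of_int (d i) * t)) o\<^sub>L C' i)"
        using laurent_poly.shift[OF shifts_cscale[OF sh[of i]], of "w i"] insert.prems by simp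
      from laurent_poly.add[OF this insert.IH] show ?case using insert by simp
    qed
    then show ?thesis by (simp add: X_def A_def[abs_def])
  qed
  ultimately show "\<exists>Y B. laurent_poly F Y B \<and> norm (weighted_sum I w C - Y) \<le> e \<and>
      (\<forall>t. norm (weighted_sum I (\<lambda>i. w i * cis (- 2 * pi * of_int (d i) * t)) C' - B t) \<le> e)"
    by blast
qed

lemma laurent_poly_carrier:
  "laurent_poly F X A \<Longrightarrow> X \<in> carrier (bounded_ops (cyl F))"
  by (induction rule: laurent_poly.induct) (auto simp: shifts_def bounded_ops_add)

text \<open>
  The Fourier transform along the axis turns the shift by \<open>d\<close> into multiplication by
  \<open>exp (- 2 \<pi> i d t)\<close>, so it turns a Laurent polynomial into multiplication by its symbol.
\<close>

lemma laurent_poly_fourier: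
  assumes "laurent_poly F X A" "finite_slices u"
  shows "finite_slices (X u) \<and> (\<forall>t. fourier (X u) t = A t (fourier u t))"
  using assms
proof (induction rule: laurent_poly.induct)
  case (shift d X Y)
  let ?K = "{k. slice k u \<noteq> 0}"
  have K: "finite ?K" using shift by (simp add: finite_slices_def)
  have X: "slice k (X u) = Y (slice (k - d) u)" for k using shift by (simp add: shifts_def)
  have Y: "is_clinear Y" using shift by (auto simp: shifts_def dest: bounded_ops_clinear)
  have fin: "finite ((\<lambda>k. k + d) ` ?K)" using K by simp
  have van: "slice k (X u) = 0" if "k \<notin> (\<lambda>k. k + d) ` ?K" for k
  proof -
    have "k - d \<notin> ?K" using that by force
    then show ?thesis by (simp add: X)
  qed
  have "fourier (X u) t = (cscale_op (cis (- 2 * pi * of_int d * t)) o\<^sub>L Y) (fourier u t)" for t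
  proof -
    have "fourier (X u) t = (\<Sum>k\<in>(\<lambda>k. k + d) ` ?K. cscale (cis (- 2 * pi * of_int k * t)) (slice k (X u)))"
      by (rule fourier_eq[OF fin van])
    also have "\<dots> = (\<Sum>k\<in>?K. cscale (cis (- 2 * pi * of_int (k + d) * t)) (Y (slice k u)))"
      by (subst sum.reindex) (simp_all add: inj_on_def X)
    also have "\<dots> = (\<Sum>k\<in>?K. cscale (cis (- 2 * pi * of_int d * t))
        (Y (cscale (cis (- 2 * pi * of_int k * t)) (slice k u))))"
      by (intro sum.cong refl)
         (simp add: is_clinearD[OF Y] cscale_cscale cis_mult algebra_simps)
    also have "\<dots> = (cscale_op (cis (- 2 * pi * of_int d * t)) o\<^sub>L Y) (fourier u t)"
      by (simp add: fourier_def blinfun.sum_right cscale_op.rep_eq[symmetric])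
    finally show ?thesis .
  qed
  then show ?case using finite_slicesI[OF fin van] by blast
next
  case (add X A Y B)
  then have fin: "finite {k. slice k (X u) \<noteq> 0}" "finite {k. slice k (Y u) \<noteq> 0}"
    by (simp_all add: finite_slices_def)
  let ?K = "{k. slice k (X u) \<noteq> 0} \<union> {k. slice k (Y u) \<noteq> 0}"
  have K: "finite ?K" using fin by simp
  have van: "slice k ((X + Y) u) = 0" "slice k (X u) = 0" "slice k (Y u) = 0" if "k \<notin> ?K" for k
    using that by (auto simp: blinfun.add_left slice_add)
  have "fourier ((X + Y) u) t = fourier (X u) t + fourier (Y u) t" for t
  proof -
    note f = fourier_eq[OF K, of _ t]
    show ?thesis
      by (subst f, erule van(1), subst f, erule van(2), subst f, erule van(3))
         (simp only: blinfun.add_left slice_add cscale_add sum.distrib)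
  qed
  then show ?case using add finite_slicesI[OF K van(1)] by (simp add: blinfun.add_left)
qed

lemma continuous_cscale_op_cis:
  "continuous_on UNIV (\<lambda>t::real. cscale_op (cis (a * t)) o\<^sub>L (Y :: 'a ell2 \<Rightarrow>\<^sub>L 'a ell2))"
proof -
  have "(\<lambda>t::real. cscale_op (cis (a * t)) o\<^sub>L Y) =
      (\<lambda>t. cos (a * t) *\<^sub>R Y + sin (a * t) *\<^sub>R (cscale_op \<i> o\<^sub>L Y))"
    by (intro ext blinfun_eqI ell2_eqI)
       (simp add: cscale_op.rep_eq blinfun.add_left blinfun.scaleR_left plus_ell2.rep_eq scaleR_ell2_def
          cscale.rep_eq complex_eq_iff algebra_simps)
  then show ?thesis by (simp only:) (intro continuous_intros)
qed

lemma laurent_continuous: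
  assumes "laurent F X A"
  shows "continuous_on UNIV A"
proof -
  have poly: "continuous_on UNIV B" if "laurent_poly F Y B" for Y B
    using that by (induction rule: laurent_poly.induct) (intro continuous_cscale_op_cis continuous_intros)+
  show ?thesis unfolding continuous_on_iff
  proof (intro ballI allI impI)
    fix t e :: real assume e: "0 < e"
    obtain Y B where B: "laurent_poly F Y B" "\<And>t. norm (A t - B t) \<le> e / 3"
      using laurentE[OF assms, of "e / 3"] e by (metis zero_less_divide_iff zero_less_numeral)
    obtain d where d: "d > 0" "\<And>s. dist s t < d \<Longrightarrow> dist (B s) (B t) < e / 3"
      using poly[OF B(1), unfolded continuous_on_iff] e by (metis UNIV_I zero_less_divide_iff zero_less_numeral)
    have "dist (A s) (A t) < e" if "dist s t < d" for s
    proof -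
      have "norm ((A s - B s) + (B s - B t) - (A t - B t)) \<le> norm (A s - B s) + norm (B s - B t) + norm (A t - B t)"
        by (meson norm_triangle_ineq norm_triangle_ineq4 add_right_mono order_trans)
      then show ?thesis using B(2)[of s] B(2)[of t] d(2)[OF that] by (simp add: dist_norm)
    qed
    then show "\<exists>d>0. \<forall>x'\<in>UNIV. dist x' t < d \<longrightarrow> dist (A x') (A t) < e" using d(1) by blast
  qed
qed

lemma finite_restriction_dense:
  assumes "0 < (e :: real)"
  shows "\<exists>S. finite S \<and> norm (u - proj S u) \<le> e"
proof -
  let ?f = "\<lambda>x. (cmod (ell2_nth u x))\<^sup>2"
  have "(?f has_sum infsum ?f UNIV) UNIV" by (rule has_sum_infsum[OF ell2_summable])
  then have "\<forall>\<^sub>F S in finite_subsets_at_top UNIV. dist (sum ?f S) (infsum ?f UNIV) < e\<^sup>2"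
    unfolding has_sum_def using assms by (intro tendstoD) auto
  then obtain S where S: "finite S" "dist (sum ?f S) (infsum ?f UNIV) < e\<^sup>2"
    unfolding eventually_finite_subsets_at_top by blast
  have "(norm (u - proj S u))\<^sup>2 = infsum ?f (UNIV - S)"
    unfolding norm_ell2_square
    by (rule infsum_cong_neutral) (auto simp: minus_ell2.rep_eq proj_apply)
  also have "\<dots> = infsum ?f UNIV - sum ?f S"
    using infsum_Diff[OF ell2_summable summable_on_finite[OF S(1)], of u] S(1) by simp
  also have "\<dots> \<le> e\<^sup>2" using S(2) by (simp add: dist_real_def)
  finally show ?thesis using S(1) assms by (intro exI[of _ S]) (auto intro: power2_le_imp_le)
qed

text \<open>
  On functions with finitely many slices, integrating the bound for the symbol along the Fourier
  transform gives the bound for the operator, by Parseval's identity on both sides. Approximation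
  by a Laurent polynomial and density of finitely supported functions do the rest.
\<close>

lemma laurent_lower_bound:
  assumes X: "laurent F X A" and c: "c > 0"
    and A: "\<And>t g. t \<in> {0..1} \<Longrightarrow> proj F g = g \<Longrightarrow> c * norm g \<le> norm (A t g)"
    and u: "proj (cyl F) u = u"
  shows "c * norm u \<le> norm (X u)"
proof -
  have fin: "c * norm u \<le> norm (X u)" if u: "proj (cyl F) u = u" "finite_slices u" for u
  proof (rule field_le_epsilon)
    fix e' :: real assume e': "0 < e'"
    \<comment> \<open>Chosen so that \<open>c - e\<close> stays positive and the two errors \<open>e * norm u\<close> add up to at most \<open>e'\<close>.\<close>
    define e where "e = min (c / 2) (e' / (2 * (norm u + 1)))"
    have e: "0 < e" "e < c" using c e' by (auto simp: e_def add_nonneg_pos)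
    have "2 * e * norm u \<le> 2 * e * (norm u + 1)" using e by simp
    also have "\<dots> \<le> 2 * (e' / (2 * (norm u + 1))) * (norm u + 1)"
      by (intro mult_right_mono mult_left_mono) (auto simp: e_def)
    also have "\<dots> = e'"
    proof -
      have "norm u + 1 \<noteq> 0" using norm_ge_zero[of u] by linarith
      then show ?thesis by (simp add: field_simps)
    qed
    finally have ee: "2 * e * norm u \<le> e'" .
    obtain Y B where Y: "laurent_poly F Y B" "norm (X - Y) \<le> e" "\<And>t. norm (A t - B t) \<le> e"
      using laurentE[OF X e(1)] by metis
    have Nil: "ell2_nth v [] = 0" if "proj (cyl F) v = v" for v
      using proj_apply[of "cyl F" v "[]"] that by (simp add: cyl_def)
    have u0: "ell2_nth u [] = 0" by (rule Nil[OF u(1)])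
    have Yu0: "ell2_nth (Y u) [] = 0"
      by (rule Nil) (rule blinfun_compose_eq_apply[OF bounded_ops_left[OF laurent_poly_carrier[OF Y(1)]]])
    have fY: "finite_slices (Y u)" "\<And>t. fourier (Y u) t = B t (fourier u t)"
      using laurent_poly_fourier[OF Y(1) u(2)] by auto
    have "((\<lambda>t. (c - e)\<^sup>2 * (norm (fourier u t))\<^sup>2) has_integral (c - e)\<^sup>2 * (norm u)\<^sup>2) {0..1}"
      by (intro has_integral_mult_right fourier_parseval u(2) u0)
    moreover have "((\<lambda>t. (norm (B t (fourier u t)))\<^sup>2) has_integral (norm (Y u))\<^sup>2) {0..1}"
      using fourier_parseval[OF fY(1) Yu0] by (simp only: fY(2))
    moreover have "(c - e)\<^sup>2 * (norm (fourier u t))\<^sup>2 \<le> (norm (B t (fourier u t)))\<^sup>2" if t: "t \<in> {0..1}" for t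
    proof -
      let ?g = "fourier u t"
      have "c * norm ?g \<le> norm (A t ?g)" by (rule A[OF t fourier_in_range[OF u(1)]])
      also have "\<dots> = norm (B t ?g + (A t - B t) ?g)" by (simp add: blinfun.diff_left)
      also have "\<dots> \<le> norm (B t ?g) + norm ((A t - B t) ?g)" by (rule norm_triangle_ineq)
      also have "norm ((A t - B t) ?g) \<le> e * norm ?g"
        using norm_blinfun[of "A t - B t" ?g] mult_right_mono[OF Y(3)[of t] norm_ge_zero[of ?g]] by linarith
      finally have "(c - e) * norm ?g \<le> norm (B t ?g)" by (simp add: algebra_simps)
      then have "((c - e) * norm ?g)\<^sup>2 \<le> (norm (B t ?g))\<^sup>2" using e by (intro power_mono) auto
      then show ?thesis by (simp add: power_mult_distrib)
    qed
    ultimately have "(c - e)\<^sup>2 * (norm u)\<^sup>2 \<le> (norm (Y u))\<^sup>2" by (rule has_integral_le)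
    then have "((c - e) * norm u)\<^sup>2 \<le> (norm (Y u))\<^sup>2" by (simp add: power_mult_distrib)
    then have 1: "(c - e) * norm u \<le> norm (Y u)" by (rule power2_le_imp_le) simp
    have "norm (Y u) = norm (X u - (X - Y) u)" by (simp add: blinfun.diff_left)
    also have "\<dots> \<le> norm (X u) + norm ((X - Y) u)" by (rule norm_triangle_ineq4)
    also have "norm ((X - Y) u) \<le> e * norm u"
      using norm_blinfun[of "X - Y" u] mult_right_mono[OF Y(2) norm_ge_zero[of u]] by linarith
    finally show "c * norm u \<le> norm (X u) + e'" using 1 ee by (simp add: algebra_simps)
  qed
  show ?thesis
  proof (rule field_le_epsilon)
    fix e' :: real assume e': "0 < e'"
    have p: "norm X + c > 0" using c by (simp add: add_nonneg_pos)
    obtain S where S: "finite S" "norm (u - proj S u) \<le> e' / (norm X + c)"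
      using finite_restriction_dense[of "e' / (norm X + c)" u] e' p by auto
    define v where "v = proj S u"
    have "slice k v = 0" if "k \<notin> hd ` S" for k
      using that by (intro ell2_eqI) (force simp: v_def slice.rep_eq proj_apply zero_ell2.rep_eq)
    then have "finite_slices v" using S(1) by (intro finite_slicesI[of "hd ` S"]) auto
    moreover have "proj (cyl F) v = v"
    proof (rule ell2_eqI)
      show "ell2_nth (proj (cyl F) v) x = ell2_nth v x" for x
        using proj_apply[of "cyl F" u x] by (auto simp: v_def proj_apply u)
    qed
    ultimately have 1: "c * norm v \<le> norm (X v)" by (intro fin)
    have "norm (X v) = norm (X u - X (u - v))" by (simp add: blinfun.diff_right)
    also have "\<dots> \<le> norm (X u) + norm (X (u - v))" by (rule norm_triangle_ineq4)
    also have "norm (X (u - v)) \<le> norm X * norm (u - v)" by (rule norm_blinfun)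
    finally have 2: "norm (X v) \<le> norm (X u) + norm X * norm (u - v)" by simp
    have "c * norm u \<le> c * (norm v + norm (u - v))"
      using norm_triangle_ineq[of v "u - v"] c by (intro mult_left_mono) auto
    then have "c * norm u \<le> norm (X u) + (norm X + c) * norm (u - v)"
      using 1 2 by (simp add: algebra_simps)
    also have "(norm X + c) * norm (u - v) \<le> (norm X + c) * (e' / (norm X + c))"
      using S(2) p by (intro mult_left_mono) (auto simp: v_def)
    finally show "c * norm u \<le> norm (X u) + e'" using p by simp
  qed
qed

text \<open>
  A lower bound survives small perturbations in norm with half its constant, so finitely many
  constants serve the whole compact interval.
\<close>

lemma bounded_below_uniformly:
  assumes A: "continuous_on UNIV (A :: real \<Rightarrow> 'a ell2 \<Rightarrow>\<^sub>L 'a ell2)"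
    and b: "\<And>t. t \<in> {0..1} \<Longrightarrow> bounded_below F (A t)"
  shows "\<exists>c>0. \<forall>t\<in>{0..1}. \<forall>g. proj F g = g \<longrightarrow> c * norm g \<le> norm (A t g)"
proof -
  have "\<exists>d>0. \<exists>c>0. \<forall>s g. dist s t < d \<longrightarrow> proj F g = g \<longrightarrow> c * norm g \<le> norm (A s g)"
    if t: "t \<in> {0..1}" for t
  proof -
    obtain c where c: "c > 0" "\<And>g. proj F g = g \<Longrightarrow> c * norm g \<le> norm (A t g)"
      using b[OF t] unfolding bounded_below_def by blast
    obtain d where d: "d > 0" "\<And>s. dist s t < d \<Longrightarrow> dist (A s) (A t) < c / 2"
      using A[unfolded continuous_on_iff] c(1) by (metis UNIV_I half_gt_zero)
    have "c / 2 * norm g \<le> norm (A s g)" if s: "dist s t < d" and g: "proj F g = g" for s g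
    proof -
      have "norm (A t g) = norm (A s g - (A s - A t) g)" by (simp add: blinfun.diff_left)
      also have "\<dots> \<le> norm (A s g) + norm ((A s - A t) g)" by (rule norm_triangle_ineq4)
      also have "norm ((A s - A t) g) \<le> c / 2 * norm g"
        using norm_blinfun[of "A s - A t" g] mult_right_mono[OF less_imp_le[OF d(2)[OF s]] norm_ge_zero[of g]]
        by (simp add: dist_norm)
      finally show ?thesis using c(2)[OF g] by simp
    qed
    then show ?thesis using d(1) c(1) by (metis half_gt_zero)
  qed
  then obtain d c where dc: "\<And>t. t \<in> {0..1} \<Longrightarrow> d t > (0::real)" "\<And>t. t \<in> {0..1} \<Longrightarrow> c t > (0::real)"
    "\<And>t s g. t \<in> {0..1} \<Longrightarrow> dist s t < d t \<Longrightarrow> proj F g = g \<Longrightarrow> c t * norm g \<le> norm (A s g)"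
    by metis
  obtain D where D: "D \<subseteq> {0..1}" "finite D" "{0..1} \<subseteq> (\<Union>t\<in>D. ball t (d t))"
    using compactE_image[OF compact_Icc[of "0::real" 1], of "{0..1}" "\<lambda>t. ball t (d t)"] dc(1)
    by (metis (no_types, lifting) UN_I centre_in_ball open_ball subsetI)
  define m where "m = Min (insert 1 (c ` D))"
  have m: "m > 0" "\<And>t. t \<in> D \<Longrightarrow> m \<le> c t" using D dc(2) by (auto simp: m_def)
  have "m * norm g \<le> norm (A s g)" if s: "s \<in> {0..1}" and g: "proj F g = g" for s g
  proof -
    obtain t where t: "t \<in> D" "dist s t < d t" using D(3) s by (auto simp: dist_commute)
    have "m * norm g \<le> c t * norm g" using m(2)[OF t(1)] by (intro mult_right_mono) auto
    also have "\<dots> \<le> norm (A s g)" using dc(3)[OF _ t(2) g] t(1) D(1) by blast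
    finally show ?thesis .
  qed
  then show ?thesis using m(1) by blast
qed

lemma laurent_bounded_below:
  assumes "laurent F X A" "\<And>t. t \<in> {0..1} \<Longrightarrow> bounded_below F (A t)"
  shows "bounded_below (cyl F) X"
proof -
  obtain c where "c > 0" "\<And>t g. t \<in> {0..1} \<Longrightarrow> proj F g = g \<Longrightarrow> c * norm g \<le> norm (A t g)"
    using bounded_below_uniformly[OF laurent_continuous[OF assms(1)] assms(2)] by blast
  then show ?thesis using laurent_lower_bound[OF assms(1)] unfolding bounded_below_def by blast
qed

section \<open>Wave packets\<close>

text \<open>
  Consecutive squares are \<open>2 n + 1\<close> apart, so different windows are disjoint.
\<close>

definition window :: "nat \<Rightarrow> int set" where "window n = {int (n\<^sup>2)..<int (n\<^sup>2 + n)}"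

lemma finite_window [simp]: "finite (window n)" and card_window [simp]: "card (window n) = n"
  by (simp_all add: window_def)

lemma window_disjoint:
  assumes "k \<in> window m" "k \<in> window n"
  shows "m = n"
proof (rule ccontr)
  have *: False if "m < n" "k \<in> window m" "k \<in> window n" for m n
  proof -
    have "(m + 1)\<^sup>2 \<le> n\<^sup>2" using that(1) by (intro power_mono) auto
    then have "m\<^sup>2 + m \<le> n\<^sup>2" by (simp add: power2_eq_square algebra_simps)
    then have "int (m\<^sup>2 + m) \<le> int (n\<^sup>2)" by (simp only: of_nat_le_iff)
    then show False using that(2,3) unfolding window_def atLeastLessThan_iff by linarith
  qed
  assume "m \<noteq> n"
  then show False using *[of m n] *[of n m] assms by linarith
qed

text \<open>
  The plane wave of frequency \<open>t\<close> cut off to the window, normalised, and tensored with \<open>g\<close>.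
\<close>

definition packet :: "nat \<Rightarrow> real \<Rightarrow> int list ell2 \<Rightarrow> int list ell2"
  where "packet n t g = (\<Sum>k\<in>window n. cscale (cis (2 * pi * of_int k * t) / complex_of_real (sqrt n)) (emb k g))"

lemma slice_packet:
  "slice j (packet n t g) = (if j \<in> window n then cscale (cis (2 * pi * of_int j * t) / complex_of_real (sqrt n)) g else 0)"
proof -
  have "slice j (packet n t g) = (\<Sum>k\<in>window n.
      if k = j then cscale (cis (2 * pi * of_int k * t) / complex_of_real (sqrt n)) g else 0)"
    unfolding packet_def slice_sum slice_cscale slice_emb
    by (intro sum.cong) (auto simp: cscale_zero)
  then show ?thesis by (simp add: sum.delta)
qed

lemma ell2_nth_sum: "ell2_nth (sum f A) x = (\<Sum>i\<in>A. ell2_nth (f i) x)"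
  by (induction A rule: infinite_finite_induct) (simp_all add: zero_ell2.rep_eq plus_ell2.rep_eq)

lemma packet_Nil: "ell2_nth (packet n t g) [] = 0"
  by (simp add: packet_def ell2_nth_sum cscale.rep_eq emb.rep_eq)

lemma packet_support:
  assumes "ell2_nth (packet n t g) x \<noteq> 0"
  shows "hd x \<in> window n"
proof (rule ccontr)
  assume n: "hd x \<notin> window n"
  have x: "x \<noteq> []" using assms packet_Nil by metis
  have "ell2_nth (slice (hd x) (packet n t g)) (increments x) = 0"
    using n by (simp add: slice_packet zero_ell2.rep_eq)
  then show False using assms x by (simp add: slice.rep_eq theta_inv_increments)
qed

lemma slices_eqI:
  assumes "\<And>k. slice k u = slice k v" "ell2_nth u [] = ell2_nth v []"
  shows "u = v"
proof (rule ell2_eqI)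
  fix x show "ell2_nth u x = ell2_nth v x"
  proof (cases "x = []")
    case False
    have "ell2_nth (slice (hd x) u) (increments x) = ell2_nth (slice (hd x) v) (increments x)"
      by (simp only: assms)
    then show ?thesis using False by (simp add: slice.rep_eq theta_inv_increments)
  qed (simp add: assms)
qed

lemma cscale_diff: "cscale c (f - g) = cscale c f - cscale c g"
  by transfer (simp add: algebra_simps)

lemma packet_add: "packet n t (f + g) = packet n t f + packet n t g"
  by (rule slices_eqI) (auto simp: slice_packet slice_add cscale_add packet_Nil plus_ell2.rep_eq)

lemma packet_diff: "packet n t (f - g) = packet n t f - packet n t g"
  by (rule slices_eqI) (auto simp: slice_packet slice_diff cscale_diff packet_Nil minus_ell2.rep_eq)

lemma packet_in_range:
  assumes "proj F g = g"
  shows "proj (cyl F) (packet n t g) = packet n t g"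
  by (rule slices_eqI)
     (simp_all add: slice_proj slice_packet is_clinearD[OF is_clinear_proj] assms proj_apply packet_Nil)

lemma norm_packet:
  assumes "n > 0"
  shows "norm (packet n t g) = norm g"
proof (rule power2_eq_imp_eq)
  have "(norm (packet n t g))\<^sup>2 = (\<Sum>k\<in>window n. (norm (slice k (packet n t g)))\<^sup>2)"
    by (rule norm_square_slices) (auto simp: slice_packet packet_Nil)
  also have "\<dots> = (\<Sum>k\<in>window n. (norm g)\<^sup>2 / n)"
    by (intro sum.cong refl) (simp add: slice_packet norm_cscale norm_divide power_divide power_mult_distrib)
  also have "\<dots> = (norm g)\<^sup>2" using assms by simp
  finally show "(norm (packet n t g))\<^sup>2 = (norm g)\<^sup>2" .
qed auto

lemma packet_orthogonal:
  assumes "m \<noteq> n"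
  shows "orthogonal (packet m t g) (packet n t g)"
proof -
  have "ell2_nth (packet m t g) x = 0 \<or> ell2_nth (packet n t g) x = 0" for x
    using packet_support window_disjoint assms by metis
  then have "Re (cnj (ell2_nth (packet m t g) x) * ell2_nth (packet n t g) x) = 0" for x
    by (metis complex_cnj_zero mult_zero_left mult_zero_right zero_complex.simps(1))
  then show ?thesis unfolding orthogonal_def inner_ell2_eq by simp
qed

lemma card_window_boundary:
  "finite {j. (j - d \<in> window n) \<noteq> (j \<in> window n)}"
  "real (card {j. (j - d \<in> window n) \<noteq> (j \<in> window n)}) \<le> 4 * \<bar>of_int d\<bar>"
proof -
  let ?a = "int (n\<^sup>2)" and ?b = "int (n\<^sup>2 + n)"
  let ?S = "{?a - \<bar>d\<bar>..<?a + \<bar>d\<bar>} \<union> {?b - \<bar>d\<bar>..<?b + \<bar>d\<bar>}"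
  have sub: "{j. (j - d \<in> window n) \<noteq> (j \<in> window n)} \<subseteq> ?S"
    unfolding window_def by (auto simp del: of_nat_add of_nat_power)
  then show "finite {j. (j - d \<in> window n) \<noteq> (j \<in> window n)}" by (rule finite_subset) simp
  have "card {j. (j - d \<in> window n) \<noteq> (j \<in> window n)} \<le> card ?S"
    by (rule card_mono[OF _ sub]) simp
  also have "\<dots> \<le> nat (2 * \<bar>d\<bar>) + nat (2 * \<bar>d\<bar>)"
    by (rule order_trans[OF card_Un_le]) simp
  finally show "real (card {j. (j - d \<in> window n) \<noteq> (j \<in> window n)}) \<le> 4 * \<bar>of_int d\<bar>"
    by linarith
qed

text \<open>
  A plane wave is an eigenfunction of the shift. Cutting it off disturbs this only within distance
  \<open>\<bar>d\<bar>\<close> of the ends of the window, at a bounded number of heights, each of which contributes a term of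
  order \<open>1 / n\<close> to the square of the norm.
\<close>

lemma shifts_packet:
  assumes sh: "shifts F d X Y"
  shows "(\<lambda>n. X (packet n t g) - packet n t ((cscale_op (cis (- 2 * pi * of_int d * t)) o\<^sub>L Y) g)) \<longlonglongrightarrow> 0"
proof -
  define h where "h = (cscale_op (cis (- 2 * pi * of_int d * t)) o\<^sub>L Y) g"
  define v where "v n = X (packet n t g) - packet n t h" for n
  have X: "X \<in> carrier (bounded_ops (cyl F))" "slice k (X u) = Y (slice (k - d) u)" for k u
    using sh by (auto simp: shifts_def)
  have Y: "is_clinear Y" using sh by (auto simp: shifts_def dest: bounded_ops_clinear)
  have bound: "(norm (v n))\<^sup>2 \<le> 4 * \<bar>of_int d\<bar> * (norm (Y g))\<^sup>2 / n" for n
  proof -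
    let ?S = "{j. (j - d \<in> window n) \<noteq> (j \<in> window n)}"
    let ?c = "\<lambda>j. cis (2 * pi * of_int (j - d) * t) / complex_of_real (sqrt n)"
    have sl: "slice j (v n) = (if j - d \<in> window n then cscale (?c j) (Y g) else 0)
        - (if j \<in> window n then cscale (?c j) (Y g) else 0)" for j
      unfolding v_def slice_diff X(2) slice_packet h_def
      by (simp add: is_clinearD[OF Y] cscale_op.rep_eq cscale_cscale cis_mult
          left_diff_distrib right_diff_distrib)
    have z: "slice j (v n) = 0" if "j \<notin> ?S" for j using that by (auto simp: sl)
    have "proj (cyl F) (X u) = X u" for u by (rule blinfun_compose_eq_apply[OF bounded_ops_left[OF X(1)]])
    then have "ell2_nth (X u) [] = 0" for u using proj_apply[of "cyl F" "X u" "[]"] by (simp add: cyl_def)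
    then have "ell2_nth (v n) [] = 0" by (simp add: v_def minus_ell2.rep_eq packet_Nil)
    then have "(norm (v n))\<^sup>2 = (\<Sum>j\<in>?S. (norm (slice j (v n)))\<^sup>2)"
      by (intro norm_square_slices card_window_boundary z)
    also have "\<dots> = (\<Sum>j\<in>?S. (norm (Y g))\<^sup>2 / n)"
      by (intro sum.cong refl)
         (auto simp: sl norm_cscale norm_divide power_divide power_mult_distrib)
    also have "\<dots> = real (card ?S) * ((norm (Y g))\<^sup>2 / n)" by simp
    also have "\<dots> \<le> 4 * \<bar>of_int d\<bar> * ((norm (Y g))\<^sup>2 / n)"
      by (intro mult_right_mono card_window_boundary) simp
    finally show ?thesis by simp
  qed
  have "(\<lambda>n. (norm (v n))\<^sup>2) \<longlonglongrightarrow> 0"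
    by (rule Lim_null_comparison[OF _ lim_const_over_n[of "4 * \<bar>of_int d\<bar> * (norm (Y g))\<^sup>2"]])
       (use bound in simp)
  then have "(\<lambda>n. sqrt ((norm (v n))\<^sup>2)) \<longlonglongrightarrow> sqrt 0" by (rule tendsto_real_sqrt)
  then show ?thesis by (simp add: tendsto_norm_zero_iff v_def h_def)
qed

lemma laurent_poly_packet:
  assumes "laurent_poly F X A"
  shows "(\<lambda>n. X (packet n t g) - packet n t (A t g)) \<longlonglongrightarrow> 0"
  using assms
proof (induction rule: laurent_poly.induct)
  case (shift d X Y)
  then show ?case by (rule shifts_packet)
next
  case (add X A Y B)
  from tendsto_add[OF add.IH] show ?case
    by (simp only: blinfun.add_left packet_add add_diff_add add_0_right)
qed

lemma laurent_packet:
  assumes "laurent F X A"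
  shows "(\<lambda>n. X (packet n t g) - packet n t (A t g)) \<longlonglongrightarrow> 0"
proof (rule LIMSEQ_I)
  fix r :: real assume r: "0 < r"
  define e where "e = r / (4 * (norm g + 1))"
  have g1: "norm g + 1 > 0" by (simp add: add_nonneg_pos)
  have e: "e > 0" using r g1 by (simp add: e_def)
  have "e * norm g \<le> e * (norm g + 1)" using e by simp
  also have "\<dots> = r / 4" using g1 by (simp add: e_def field_simps)
  finally have eg: "e * norm g \<le> r / 4" .
  obtain Y B where Y: "laurent_poly F Y B" "norm (X - Y) \<le> e" "\<And>t. norm (A t - B t) \<le> e"
    using laurentE[OF assms e] by metis
  obtain n0 where n0: "\<And>n. n \<ge> n0 \<Longrightarrow> norm (Y (packet n t g) - packet n t (B t g)) < r / 4"
    using LIMSEQ_D[OF laurent_poly_packet[OF Y(1), of t g], of "r / 4"] r by auto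
  have "norm (X (packet n t g) - packet n t (A t g)) < r" if n: "n \<ge> max n0 1" for n
  proof -
    let ?p = "packet n t g"
    have "X ?p - packet n t (A t g)
        = (X - Y) ?p + (Y ?p - packet n t (B t g)) - packet n t ((A t - B t) g)"
      by (simp add: blinfun.diff_left packet_diff)
    moreover have "norm (a + b - c) \<le> norm a + norm b + norm c" for a b c :: "int list ell2"
      using norm_triangle_ineq4[of "a + b" c] norm_triangle_ineq[of a b] by linarith
    ultimately have "norm (X ?p - packet n t (A t g))
        \<le> norm ((X - Y) ?p) + norm (Y ?p - packet n t (B t g)) + norm (packet n t ((A t - B t) g))"
      by simp
    moreover have "norm ((X - Y) ?p) \<le> e * norm g"
      using norm_blinfun[of "X - Y" ?p] mult_right_mono[OF Y(2) norm_ge_zero[of g]] n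
      by (simp add: norm_packet)
    moreover have "norm (packet n t ((A t - B t) g)) \<le> e * norm g"
      using norm_blinfun[of "A t - B t" g] mult_right_mono[OF Y(3)[of t] norm_ge_zero[of g]] n
      by (simp add: norm_packet)
    moreover have "norm (Y ?p - packet n t (B t g)) < r / 4" using n0 n by simp
    ultimately show ?thesis using eg r by linarith
  qed
  then show "\<exists>no. \<forall>n\<ge>no. norm (X (packet n t g) - packet n t (A t g) - 0) < r"
    unfolding diff_zero by blast
qed

text \<open>
  Scale the vectors to norm at most \<open>1\<close>. Were all images large, a subsequence of them would converge to some \<open>l \<noteq> 0\<close>. The sum of \<open>m\<close> terms of
  this subsequence would be close to \<open>m l\<close>, whereas a sum of \<open>m\<close> orthogonal vectors of norm at most \<open>1\<close>
  has norm at most \<open>\<surd>m\<close>.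
\<close>

lemma compact_op_orthogonal:
  fixes f :: "nat \<Rightarrow> 'a ell2" and e :: real
  assumes A: "A \<in> compact_ops E" and orth: "\<And>m n. m \<noteq> n \<Longrightarrow> orthogonal (f m) (f n)"
    and bd: "\<And>n. n \<ge> N \<Longrightarrow> norm (f n) \<le> C" and e: "0 < e"
  shows "\<exists>n\<ge>N. norm (A (f n)) < e"
proof (rule ccontr)
  assume "\<not> ?thesis"
  then have large: "norm (A (f n)) \<ge> e" if "n \<ge> N" for n using that by force
  define D where "D = \<bar>C\<bar> + 1"
  have D: "D > 0" by (simp add: D_def)
  define h where "h n = (1 / D) *\<^sub>R f (N + n)" for n
  have h1: "norm (h n) \<le> 1" for n
  proof -
    have "norm (f (N + n)) \<le> D" using bd[of "N + n"] by (simp add: D_def)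
    then show ?thesis using D by (simp add: h_def)
  qed
  have hA: "norm (A (h n)) \<ge> e / D" for n
    using large[of "N + n"] D by (simp add: h_def blinfun.scaleR_right divide_right_mono)
  have ho: "orthogonal (h m) (h n)" if "m \<noteq> n" for m n
    using orth[of "N + m" "N + n"] that by (simp add: h_def orthogonal_def)
  obtain K where K: "compact K" "blinfun_apply A ` cball 0 1 \<subseteq> K" using A by (rule compact_opsD)
  have "\<forall>n. A (h n) \<in> K" by (intro allI subsetD[OF K(2)] imageI) (simp add: h1)
  then obtain l r where l: "l \<in> K" "strict_mono (r :: nat \<Rightarrow> nat)" "((\<lambda>n. A (h n)) \<circ> r) \<longlonglongrightarrow> l"
    using K(1)[unfolded compact_def, rule_format, of "\<lambda>n. A (h n)"] by auto
  have nl: "norm l \<ge> e / D"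
    by (rule Lim_bounded2[OF tendsto_norm[OF l(3)], of 0]) (simp add: hA)
  define q where "q = e / (2 * D)"
  have q: "q > 0" "norm l \<ge> 2 * q" using e D nl by (auto simp: q_def)
  obtain M where M: "\<And>n. n \<ge> M \<Longrightarrow> norm (A (h (r n)) - l) < q"
    using LIMSEQ_D[OF l(3) q(1)] by auto
  have bound: "real m * q \<le> norm A * sqrt (real m)" for m
  proof -
    let ?I = "{M..<M + m}"
    let ?s = "\<Sum>i\<in>?I. h (r i)"
    have "(norm ?s)\<^sup>2 = (\<Sum>i\<in>?I. (norm (h (r i)))\<^sup>2)"
      by (rule norm_sum_Pythagorean)
         (auto simp: pairwise_def intro!: ho dest: strict_mono_eq[OF l(2), THEN iffD1])
    also have "\<dots> \<le> (\<Sum>i\<in>?I. 1)" using h1 by (intro sum_mono) (simp add: power_le_one)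
    finally have "norm ?s \<le> sqrt (real m)" by (intro real_le_rsqrt) simp
    then have 1: "norm (A ?s) \<le> norm A * sqrt (real m)"
      by (meson norm_blinfun norm_ge_zero mult_left_mono order_trans)
    have "norm (A ?s - real m *\<^sub>R l) = norm (\<Sum>i\<in>?I. A (h (r i)) - l)"
      by (simp add: blinfun.sum_right sum_subtractf sum_constant_scaleR del: sum_constant)
    also have "\<dots> \<le> (\<Sum>i\<in>?I. q)" using M by (intro sum_norm_le) (auto intro: less_imp_le)
    finally have 2: "norm (A ?s - real m *\<^sub>R l) \<le> real m * q" by simp
    have "real m * (2 * q) \<le> real m * norm l" using q(2) by (intro mult_left_mono) auto
    also have "\<dots> = norm (A ?s - (A ?s - real m *\<^sub>R l))" by simp
    also have "\<dots> \<le> norm (A ?s) + norm (A ?s - real m *\<^sub>R l)" by (rule norm_triangle_ineq4)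
    finally show ?thesis using 1 2 by linarith
  qed
  obtain m :: nat where m: "(norm A / q)\<^sup>2 < real m" using reals_Archimedean2 by blast
  have "norm A / q < sqrt (real m)" using m by (rule real_less_rsqrt)
  then have a: "norm A < q * sqrt (real m)" using q(1) by (simp add: field_simps)
  have "m > 0" using m by (metis gr0I not_less of_nat_0 zero_le_power2)
  then have "norm A * sqrt (real m) < q * sqrt (real m) * sqrt (real m)"
    using a by (intro mult_strict_right_mono) auto
  also have "\<dots> = real m * q" by simp
  finally show False using bound[of m] by linarith
qed

text \<open>
  Apply \<open>S X = 1 + K\<close> to a packet \<open>p\<close> of \<open>g\<close> for which \<open>K p\<close> is small: \<open>\<parallel>g\<parallel> = \<parallel>p\<parallel>\<close> is bounded by
  \<open>\<parallel>S\<parallel> \<parallel>X p\<parallel>\<close> up to a small error, and \<open>\<parallel>X p\<parallel>\<close> is close to the norm of the symbol applied to \<open>g\<close>.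
\<close>

lemma fredholm_left_symbol:
  assumes X: "laurent F X A" and S: "(S o\<^sub>L X) - proj (cyl F) \<in> compact_ops (cyl F)"
  shows "bounded_below F (A t)"
  unfolding bounded_below_def
proof (intro exI[of _ "1 / (norm S + 1)"] conjI allI impI)
  show "1 / (norm S + 1) > 0" by (simp add: add_nonneg_pos)
  fix g assume g: "proj F g = g"
  have "norm g \<le> norm S * norm (A t g)"
  proof (rule field_le_epsilon)
    fix e :: real assume e: "0 < e"
    let ?K = "(S o\<^sub>L X) - proj (cyl F)"
    define e1 where "e1 = e / (2 * (norm S + 1))"
    have S1: "norm S + 1 > 0" by (simp add: add_nonneg_pos)
    have e1: "e1 > 0" using e S1 by (simp add: e1_def)
    have "norm S * e1 \<le> (norm S + 1) * e1" using e1 by simp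
    also have "\<dots> = e / 2" using S1 by (simp add: e1_def field_simps)
    finally have Se: "norm S * e1 \<le> e / 2" .
    obtain n0 where n0: "\<And>n. n \<ge> n0 \<Longrightarrow> norm (X (packet n t g) - packet n t (A t g)) < e1"
      using LIMSEQ_D[OF laurent_packet[OF X, of t g] e1] by auto
    obtain n where n: "n \<ge> max n0 1" "norm (?K (packet n t g)) < e / 2"
      using compact_op_orthogonal[OF S, of "\<lambda>n. packet n t g" "max n0 1" "norm g" "e / 2"]
        packet_orthogonal norm_packet e by auto
    let ?p = "packet n t g"
    have "?p = S (X ?p) - ?K ?p" by (simp add: blinfun.diff_left packet_in_range[OF g])
    then have "norm ?p \<le> norm (S (X ?p)) + norm (?K ?p)" by (metis norm_triangle_ineq4)
    also have "norm (S (X ?p)) \<le> norm S * norm (X ?p)" by (rule norm_blinfun)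
    also have "norm S * norm (X ?p) \<le> norm S * (norm (A t g) + e1)"
    proof (intro mult_left_mono norm_ge_zero)
      have "norm (X ?p) \<le> norm (packet n t (A t g)) + norm (X ?p - packet n t (A t g))"
        by (rule norm_triangle_sub)
      then show "norm (X ?p) \<le> norm (A t g) + e1" using n0[of n] n(1) by (simp add: norm_packet)
    qed
    finally show "norm g \<le> norm S * norm (A t g) + e"
      using n Se by (simp add: norm_packet algebra_simps)
  qed
  also have "\<dots> \<le> norm (A t g) * (norm S + 1)" by (simp add: algebra_simps)
  finally show "1 / (norm S + 1) * norm g \<le> norm (A t g)"
    using pos_divide_le_eq[of "norm S + 1" "norm g" "norm (A t g)"] norm_ge_zero[of S] by simp
qed

text \<open>
  A right inverse modulo compact operators bounds the symbol of the adjoint: for a packet \<open>p\<close> of \<open>g\<close>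
  with \<open>K p\<close> small, \<open>\<parallel>g\<parallel>\<^sup>2 = \<langle>p, p\<rangle>\<close> is close to \<open>\<langle>p, X S p\<rangle> = \<langle>X' p, S p\<rangle>\<close>.
\<close>

lemma fredholm_right_symbol:
  assumes X: "laurent F X' A'" and adj: "formal_adjoint X X'"
    and S: "(X o\<^sub>L S) - proj (cyl F) \<in> compact_ops (cyl F)"
  shows "bounded_below F (A' t)"
  unfolding bounded_below_def
proof (intro exI[of _ "1 / (norm S + 1)"] conjI allI impI)
  show "1 / (norm S + 1) > 0" by (simp add: add_nonneg_pos)
  fix g assume g: "proj F g = g"
  have "norm g \<le> norm S * norm (A' t g)"
  proof (rule field_le_epsilon)
    fix e :: real assume e: "0 < e"
    let ?K = "(X o\<^sub>L S) - proj (cyl F)"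
    define e1 where "e1 = e / (2 * (norm S + 1))"
    have S1: "norm S + 1 > 0" by (simp add: add_nonneg_pos)
    have e1: "e1 > 0" using e S1 by (simp add: e1_def)
    have "norm S * e1 \<le> (norm S + 1) * e1" using e1 by simp
    also have "\<dots> = e / 2" using S1 by (simp add: e1_def field_simps)
    finally have Se: "norm S * e1 \<le> e / 2" .
    obtain n0 where n0: "\<And>n. n \<ge> n0 \<Longrightarrow> norm (X' (packet n t g) - packet n t (A' t g)) < e1"
      using LIMSEQ_D[OF laurent_packet[OF X, of t g] e1] by auto
    obtain n where n: "n \<ge> max n0 1" "norm (?K (packet n t g)) < e / 2"
      using compact_op_orthogonal[OF S, of "\<lambda>n. packet n t g" "max n0 1" "norm g" "e / 2"]
        packet_orthogonal norm_packet e by auto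
    let ?p = "packet n t g"
    have np: "norm ?p = norm g" using n(1) by (simp add: norm_packet)
    have "?p = X (S ?p) - ?K ?p" by (simp add: blinfun.diff_left packet_in_range[OF g])
    then have "inner ?p ?p = inner ?p (X (S ?p)) - inner ?p (?K ?p)" by (metis inner_diff_right)
    also have "inner ?p (X (S ?p)) = inner (X' ?p) (S ?p)"
      using formal_adjoint_sym[OF adj] by (simp add: formal_adjoint_def)
    also have "inner (X' ?p) (S ?p) - inner ?p (?K ?p)
        \<le> norm (X' ?p) * norm (S ?p) + norm ?p * norm (?K ?p)"
      using norm_cauchy_schwarz[of "X' ?p" "S ?p"] norm_cauchy_schwarz[of ?p "- ?K ?p"] by simp
    also have "norm (X' ?p) * norm (S ?p) \<le> (norm (A' t g) + e1) * (norm S * norm ?p)"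
    proof (intro mult_mono norm_blinfun norm_ge_zero)
      have "norm (X' ?p) \<le> norm (packet n t (A' t g)) + norm (X' ?p - packet n t (A' t g))"
        by (rule norm_triangle_sub)
      then show "norm (X' ?p) \<le> norm (A' t g) + e1" using n0[of n] n(1) by (simp add: norm_packet)
    qed (use e1 in \<open>simp add: add_nonneg_nonneg\<close>)
    finally have "norm g * norm g \<le> norm g * (norm S * norm (A' t g) + norm S * e1 + norm (?K ?p))"
      by (simp add: np power2_norm_eq_inner[symmetric] power2_eq_square algebra_simps)
    then have "norm g \<le> norm S * norm (A' t g) + norm S * e1 + norm (?K ?p) \<or> norm g = 0"
      by (auto simp: mult_le_cancel_left)
    then show "norm g \<le> norm S * norm (A' t g) + e"
    proof
      assume "norm g = 0"
      moreover have "0 \<le> norm S * norm (A' t g)" by simp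
      ultimately show ?thesis using e by linarith
    qed (use n(2) Se in linarith)
  qed
  also have "\<dots> \<le> norm (A' t g) * (norm S + 1)" by (simp add: algebra_simps)
  finally show "1 / (norm S + 1) * norm g \<le> norm (A' t g)"
    using pos_divide_le_eq[of "norm S + 1" "norm g" "norm (A' t g)"] norm_ge_zero[of S] by simp
qed

section \<open>Toeplitz operators over a cylinder\<close>

lemma theta_inv_mem_cyl: "theta_inv (k # y) \<in> cyl F \<longleftrightarrow> y \<in> F"
  by (simp add: cyl_def)

lemma cyl_subset_Zpow: "F \<subseteq> Zpow n \<Longrightarrow> cyl F \<subseteq> Zpow (Suc n)"
  by (force simp: cyl_def Zpow_def)

lemma increments_Zpow: "\<eta> \<in> Zpow (Suc n) \<Longrightarrow> increments \<eta> \<in> Zpow n"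
  by (simp add: Zpow_def)

lemma Zless_eq_cyl: "Zless (Suc n) = cyl (Nstar_pow n)"
proof -
  have "sorted_wrt (<) x \<longleftrightarrow> (\<forall>i<n. 1 \<le> increments x ! i)" if "length x = Suc n" for x :: "int list"
  proof -
    have "sorted_wrt (<) x \<longleftrightarrow> (\<forall>i. Suc i < length x \<longrightarrow> x ! i < x ! Suc i)"
      by (rule sorted_wrt_iff_nth_Suc_transp) simp
    also have "\<dots> \<longleftrightarrow> (\<forall>i<n. 1 \<le> increments x ! i)" using that by (auto simp: nth_increments)
    finally show ?thesis .
  qed
  then show ?thesis by (force simp: Zless_def cyl_def Nstar_pow_def Zpow_def)
qed

lemma shifts_compressed_translate:
  assumes F: "F \<subseteq> Zpow n" and \<eta>: "\<eta> \<in> Zpow (Suc n)"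
  shows "shifts F (hd \<eta>) (compressed_translate (cyl F) \<eta>) (compressed_translate F (increments \<eta>))"
  unfolding shifts_def
proof (intro conjI allI)
  note E = cyl_subset_Zpow[OF F] and \<eta>' = increments_Zpow[OF \<eta>]
  show "compressed_translate (cyl F) \<eta> \<in> carrier (bounded_ops (cyl F))"
    by (rule compressed_translate_carrier[OF E \<eta>])
  show "compressed_translate F (increments \<eta>) \<in> carrier (bounded_ops F)"
    by (rule compressed_translate_carrier[OF F \<eta>'])
  fix k u
  show "slice k (compressed_translate (cyl F) \<eta> u) = compressed_translate F (increments \<eta>) (slice (k - hd \<eta>) u)"
  proof (rule ell2_eqI)
    fix y
    show "ell2_nth (slice k (compressed_translate (cyl F) \<eta> u)) y
        = ell2_nth (compressed_translate F (increments \<eta>) (slice (k - hd \<eta>) u)) y"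
    proof (cases "y \<in> F")
      case True
      then have "sub (theta_inv (k # y)) \<eta> = theta_inv ((k - hd \<eta>) # sub y (increments \<eta>))"
        using F by (intro sub_theta_inv[OF _ \<eta>]) auto
      then show ?thesis
        by (simp add: slice.rep_eq compressed_translate_apply[OF E \<eta>] compressed_translate_apply[OF F \<eta>']
            theta_inv_mem_cyl)
    qed (simp add: slice.rep_eq compressed_translate_apply[OF E \<eta>] compressed_translate_apply[OF F \<eta>']
            theta_inv_mem_cyl)
  qed
qed

lemma shifts_overlap:
  assumes F: "F \<subseteq> Zpow n" and \<eta>: "\<eta> \<in> Zpow (Suc n)"
  shows "shifts F 0 (overlap (cyl F) \<eta>) (overlap F (increments \<eta>))"
  unfolding shifts_def
proof (intro conjI allI overlap_carrier)
  fix k u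
  show "slice k (overlap (cyl F) \<eta> u) = overlap F (increments \<eta>) (slice (k - 0) u)"
  proof (rule ell2_eqI)
    fix y
    have "sub (theta_inv (k # y)) \<eta> = theta_inv ((k - hd \<eta>) # sub y (increments \<eta>))" if "y \<in> F"
      using F that by (intro sub_theta_inv[OF _ \<eta>]) auto
    then show "ell2_nth (slice k (overlap (cyl F) \<eta> u)) y = ell2_nth (overlap F (increments \<eta>) (slice (k - 0) u)) y"
      by (auto simp: slice.rep_eq overlap_def proj_apply theta_inv_mem_cyl)
  qed
qed

lemma bounded_linear_cscale_op: "bounded_linear (\<lambda>c. cscale_op c o\<^sub>L Y)"
proof (rule bounded_linear_intro)
  show "cscale_op (a + b) o\<^sub>L Y = (cscale_op a o\<^sub>L Y) + (cscale_op b o\<^sub>L Y)" for a b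
    by (intro blinfun_eqI ell2_eqI)
       (simp add: cscale_op.rep_eq blinfun.add_left plus_ell2.rep_eq cscale.rep_eq algebra_simps)
  show "cscale_op (r *\<^sub>R a) o\<^sub>L Y = r *\<^sub>R (cscale_op a o\<^sub>L Y)" for r a
    by (intro blinfun_eqI ell2_eqI)
       (simp add: cscale_op.rep_eq blinfun.scaleR_left scaleR_ell2_def cscale.rep_eq scaleR_conv_of_real)
  show "norm (cscale_op c o\<^sub>L Y) \<le> norm c * norm Y" for c by (rule norm_cscale_op_compose_le)
qed

context
  fixes \<phi> :: "int list \<Rightarrow> complex" and n :: nat and t :: real
  assumes \<phi>: "(\<lambda>x. cmod (\<phi> x)) summable_on Zpow (Suc n)"
begin

lemma bij_theta_inv: "bij_betw (\<lambda>(z, k). theta_inv (k # z)) (Zpow n \<times> UNIV) (Zpow (Suc n))"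
proof (rule bij_betwI[of _ _ _ "\<lambda>x. (increments x, hd x)"])
  show "(\<lambda>(z, k). theta_inv (k # z)) \<in> Zpow n \<times> UNIV \<rightarrow> Zpow (Suc n)"
    by (auto simp: Zpow_def)
  show "(\<lambda>x. (increments x, hd x)) \<in> Zpow (Suc n) \<rightarrow> Zpow n \<times> UNIV" by (auto simp: increments_Zpow)
  show "(\<lambda>(z, k). theta_inv (k # z)) (increments x, hd x) = x" if "x \<in> Zpow (Suc n)" for x
    using that theta_inv_increments[of x] by (cases "x = []") (simp_all add: Zpow_def)
qed auto

lemma norm_summable_fibres: "(\<lambda>(z, k). cmod (\<phi> (theta_inv (k # z)))) summable_on Zpow n \<times> UNIV"
  using \<phi> summable_on_reindex_bij_betw[OF bij_theta_inv, of "\<lambda>x. cmod (\<phi> x)"]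
  by (simp add: case_prod_unfold)

lemma norm_summable_fibre: "z \<in> Zpow n \<Longrightarrow> (\<lambda>k. cmod (\<phi> (theta_inv (k # z)))) summable_on UNIV"
  by (rule summable_on_SigmaD1[OF norm_summable_fibres])

lemma mu_norm_summable: "(\<lambda>z. cmod (mu t \<phi> z)) summable_on Zpow n"
proof (rule Infinite_Sum.abs_summable_on_comparison_test)
  let ?s = "\<lambda>z. \<Sum>\<^sub>\<infinity>k. cmod (\<phi> (theta_inv (k # z)))"
  have "?s summable_on Zpow n" by (rule summable_on_Sigma_banach[OF norm_summable_fibres])
  moreover have "norm (?s z) = ?s z" for z by (simp add: infsum_nonneg)
  ultimately show "(\<lambda>z. norm (?s z)) summable_on Zpow n" by simp
  fix z assume z: "z \<in> Zpow n"
  have "cmod (mu t \<phi> z) \<le> (\<Sum>\<^sub>\<infinity>k. norm (cis (- 2 * pi * of_int k * t) * \<phi> (theta_inv (k # z))))"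
    unfolding mu_def by (rule norm_infsum_bound) (simp add: norm_mult norm_summable_fibre[OF z])
  also have "\<dots> = ?s z" by (simp add: norm_mult)
  also have "\<dots> \<le> norm (?s z)" by simp
  finally show "cmod (mu t \<phi> z) \<le> norm (?s z)" .
qed

text \<open>
  The definition of \<open>mu\<close> sums over the first coordinate with a phase. Absolute convergence permits
  summing over all coordinates at once, and then the phase becomes a factor of the weight.
\<close>

lemma weighted_sum_mu:
  assumes C: "\<And>z. z \<in> Zpow n \<Longrightarrow> norm (C z) \<le> 1"
  shows "weighted_sum (Zpow n) (mu t \<phi>) C
    = weighted_sum (Zpow (Suc n)) (\<lambda>x. \<phi> x * cis (- 2 * pi * of_int (hd x) * t)) (\<lambda>x. C (increments x))"
proof -
  let ?w = "\<lambda>x. \<phi> x * cis (- 2 * pi * of_int (hd x) * t)"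
  let ?f = "\<lambda>z k. cscale_op (?w (theta_inv (k # z))) o\<^sub>L C z"
  have "(\<lambda>x. cscale_op (?w x) o\<^sub>L C (increments x)) summable_on Zpow (Suc n)"
    by (rule weighted_summable) (use \<phi> C increments_Zpow in \<open>auto simp: norm_mult\<close>)
  then have s: "(\<lambda>(z, k). ?f z k) summable_on Zpow n \<times> UNIV"
    using summable_on_reindex_bij_betw[OF bij_theta_inv, of "\<lambda>x. cscale_op (?w x) o\<^sub>L C (increments x)"]
    by (simp add: case_prod_unfold)
  have "weighted_sum (Zpow (Suc n)) ?w (\<lambda>x. C (increments x)) = (\<Sum>\<^sub>\<infinity>(z, k)\<in>Zpow n \<times> UNIV. ?f z k)"
    unfolding weighted_sum_reindex[OF bij_theta_inv] by (simp add: weighted_sum_def case_prod_unfold)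
  also have "\<dots> = (\<Sum>\<^sub>\<infinity>z\<in>Zpow n. \<Sum>\<^sub>\<infinity>k. ?f z k)" by (rule infsum_Sigma'_banach[OF s, symmetric])
  also have "\<dots> = (\<Sum>\<^sub>\<infinity>z\<in>Zpow n. cscale_op (mu t \<phi> z) o\<^sub>L C z)"
  proof (rule infsum_cong)
    fix z assume z: "z \<in> Zpow n"
    have "(\<lambda>k. cis (- 2 * pi * of_int k * t) * \<phi> (theta_inv (k # z))) summable_on UNIV"
      by (rule abs_summable_summable) (simp add: norm_mult norm_summable_fibre[OF z])
    from has_sum_bounded_linear[OF bounded_linear_cscale_op has_sum_infsum[OF this], of "C z"]
    show "(\<Sum>\<^sub>\<infinity>k. ?f z k) = cscale_op (mu t \<phi> z) o\<^sub>L C z"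
      by (intro infsumI) (simp add: mu_def mult.commute)
  qed
  finally show ?thesis by (simp add: weighted_sum_def)
qed

end

text \<open>
  Conjugation reverses the phase in the first coordinate and the reflection of that coordinate
  restores it.
\<close>

lemma mu_conjugate_reflection: "mu t (\<lambda>x. cnj (\<phi> (neg x))) z = cnj (mu t \<phi> (neg z))"
proof -
  have th: "theta_inv (- k # neg z) = neg (theta_inv (k # z))" for k
  proof (rule nth_equalityI)
    fix j assume j: "j < length (theta_inv (- k # neg z))"
    have "(- k # neg z) ! i = - ((k # z) ! i)" if "i \<le> j" for i
      using that j by (cases i) auto
    then show "theta_inv (- k # neg z) ! j = neg (theta_inv (k # z)) ! j"
      using j by (simp add: nth_theta_inv sum_negf)
  qed simp
  have bij: "bij_betw (uminus :: int \<Rightarrow> int) UNIV UNIV" by (rule bij_uminus)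
  have "cnj (mu t \<phi> (neg z)) = (\<Sum>\<^sub>\<infinity>k. cnj (cis (- 2 * pi * of_int k * t) * \<phi> (theta_inv (k # neg z))))"
    unfolding mu_def by (rule infsum_cnj[symmetric])
  also have "\<dots> = (\<Sum>\<^sub>\<infinity>k. cnj (cis (- 2 * pi * of_int (- k) * t) * \<phi> (theta_inv (- k # neg z))))"
    by (rule infsum_reindex_bij_betw[OF bij, symmetric])
  also have "\<dots> = mu t (\<lambda>x. cnj (\<phi> (neg x))) z"
    unfolding mu_def th by (simp add: cis_cnj)
  finally show ?thesis ..
qed

lemma mu_conjugate: "mu 0 (\<lambda>x. cnj (\<psi> x)) z = cnj (mu 0 \<psi> z)"
  unfolding mu_def by (subst infsum_cnj[symmetric]) simp

lemma norm_summable_reflection: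
  assumes "(\<lambda>x. cmod (\<phi> x)) summable_on Zpow n"
  shows "(\<lambda>x. cmod (cnj (\<phi> (neg x)))) summable_on Zpow n"
  using assms summable_on_reindex_bij_betw[OF bij_neg, of "\<lambda>x. cmod (\<phi> x)" n] by simp

context
  fixes F :: "int list set" and n :: nat
  assumes F: "F \<subseteq> Zpow n"
begin

text \<open>
  The first coordinate of \<open>\<eta>\<close> is the shift along the axis for the terms of \<open>T\<close>. The terms of \<open>V\<close> and the
  multiple of the identity do not shift.
\<close>

lemma laurent_toeplitz_op:
  assumes \<phi>: "(\<lambda>x. cmod (\<phi> x)) summable_on Zpow (Suc n)" and \<psi>: "(\<lambda>x. cmod (\<psi> x)) summable_on Zpow (Suc n)"
  shows "laurent F (toeplitz_op (Suc n) (cyl F) \<phi> \<psi> z) (\<lambda>t. toeplitz_op n F (mu t \<phi>) (mu 0 \<psi>) z)"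
proof -
  note E = cyl_subset_Zpow[OF F]
  have T: "laurent F (toeplitz_T (Suc n) (cyl F) \<phi>) (\<lambda>t. toeplitz_T n F (mu t \<phi>))"
  proof -
    have "toeplitz_T n F (mu t \<phi>) = weighted_sum (Zpow (Suc n))
        (\<lambda>x. \<phi> x * cis (- 2 * pi * of_int (hd x) * t)) (\<lambda>x. compressed_translate F (increments x))" for t
      unfolding toeplitz_T_weighted_sum
      by (rule weighted_sum_mu[OF \<phi>]) (rule norm_compressed_translate_le[OF F])
    then show ?thesis unfolding toeplitz_T_weighted_sum[of _ "cyl F"]
      by (simp only:) (rule laurent_weighted_sum[OF \<phi>],
        simp_all add: norm_compressed_translate_le[OF E] norm_compressed_translate_le[OF F] increments_Zpow
          shifts_compressed_translate[OF F])
  qed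
  have o: "norm (overlap G x) \<le> 1" for G x by (simp add: overlap_def norm_proj_le)
  have "laurent F (toeplitz_V (Suc n) (cyl F) \<psi>)
      (\<lambda>t. weighted_sum (Zpow (Suc n)) (\<lambda>x. \<psi> x * cis (- 2 * pi * of_int 0 * t)) (\<lambda>x. overlap F (increments x)))"
    unfolding toeplitz_V_weighted_sum[OF E]
    by (rule laurent_weighted_sum[OF \<psi>]) (simp_all add: o shifts_overlap[OF F])
  then have V: "laurent F (toeplitz_V (Suc n) (cyl F) \<psi>) (\<lambda>t. toeplitz_V n F (mu 0 \<psi>))"
    unfolding toeplitz_V_weighted_sum[OF F] weighted_sum_mu[OF \<psi> o] by simp
  have "shifts F 0 (proj (cyl F)) (proj F)"
    by (simp add: shifts_def bounded_ops_proj slice_proj)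
  then have "laurent F (cscale_op (- z) o\<^sub>L proj (cyl F))
      (\<lambda>t. cscale_op (cis (- 2 * pi * of_int 0 * t)) o\<^sub>L (cscale_op (- z) o\<^sub>L proj F))"
    by (intro laurent_if_poly laurent_poly.shift shifts_cscale)
  moreover have "cscale_op (cis (- 2 * pi * of_int 0 * t)) o\<^sub>L Y = Y" for t and Y :: "int list ell2 \<Rightarrow>\<^sub>L int list ell2"
    by (intro blinfun_eqI ell2_eqI) (simp add: cscale_op.rep_eq cscale.rep_eq)
  ultimately have Z: "laurent F (cscale_op (- z) o\<^sub>L proj (cyl F)) (\<lambda>t. cscale_op (- z) o\<^sub>L proj F)"
    by simp
  have "cscale_op (- z) o\<^sub>L Y = - (cscale_op z o\<^sub>L Y)" for Y :: "int list ell2 \<Rightarrow>\<^sub>L int list ell2"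
    by (intro blinfun_eqI ell2_eqI)
       (simp add: cscale_op.rep_eq cscale.rep_eq blinfun.minus_left uminus_ell2.rep_eq)
  then show ?thesis
    using laurent_add[OF laurent_add[OF T V] Z] by (simp add: toeplitz_op_def)
qed

context
  fixes \<phi> \<psi> :: "int list \<Rightarrow> complex" and X :: "int list ell2 \<Rightarrow>\<^sub>L int list ell2"
    and A :: "real \<Rightarrow> int list ell2 \<Rightarrow>\<^sub>L int list ell2"
  assumes \<phi>: "(\<lambda>x. cmod (\<phi> x)) summable_on Zpow (Suc n)" and \<psi>: "(\<lambda>x. cmod (\<psi> x)) summable_on Zpow (Suc n)"
  defines "X \<equiv> toeplitz_T (Suc n) (cyl F) \<phi> + toeplitz_V (Suc n) (cyl F) \<psi>"
    and "A \<equiv> \<lambda>t. toeplitz_T n F (mu t \<phi>) + toeplitz_V n F (mu 0 \<psi>)"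
begin

abbreviation T_minus where "T_minus \<equiv> toeplitz_op (Suc n) (cyl F) \<phi> \<psi>"
abbreviation symbol_minus where "symbol_minus z t \<equiv> toeplitz_op n F (mu t \<phi>) (mu 0 \<psi>) z"
abbreviation T_adj where "T_adj z \<equiv> toeplitz_op (Suc n) (cyl F) (\<lambda>x. cnj (\<phi> (neg x))) (\<lambda>x. cnj (\<psi> x)) (cnj z)"
abbreviation symbol_adj where "symbol_adj z t \<equiv> toeplitz_op n F (mu t (\<lambda>x. cnj (\<phi> (neg x)))) (mu 0 (\<lambda>x. cnj (\<psi> x))) (cnj z)"

lemma laurent_T_minus: "laurent F (T_minus z) (symbol_minus z)"
  by (rule laurent_toeplitz_op[OF \<phi> \<psi>])

lemma laurent_T_adj: "laurent F (T_adj z) (symbol_adj z)"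
  by (rule laurent_toeplitz_op[OF norm_summable_reflection[OF \<phi>]]) (simp add: \<psi>)

lemma adjoint_T_minus: "formal_adjoint (T_minus z) (T_adj z)"
  by (rule toeplitz_op_adjoint[OF cyl_subset_Zpow[OF F] \<phi> \<psi>])

lemma adjoint_symbol_minus: "formal_adjoint (symbol_minus z t) (symbol_adj z t)"
  using toeplitz_op_adjoint[OF F mu_norm_summable[OF \<phi>] mu_norm_summable[OF \<psi>]]
  by (simp only: mu_conjugate_reflection[abs_def] mu_conjugate[abs_def])

lemma carrier_T_minus: "T_minus z \<in> carrier (bounded_ops (cyl F))"
  by (rule toeplitz_op_carrier[OF cyl_subset_Zpow[OF F] \<phi> \<psi>])

lemma carrier_symbol_minus: "symbol_minus z t \<in> carrier (bounded_ops F)"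
  by (rule toeplitz_op_carrier[OF F mu_norm_summable[OF \<phi>] mu_norm_summable[OF \<psi>]])

lemma spectrum_X: "z \<in> spectrum (cyl F) X \<longleftrightarrow> T_minus z \<notin> Units (bounded_ops (cyl F))"
  using spectrum_iff[OF toeplitz_sum_carrier[OF cyl_subset_Zpow[OF F] \<phi> \<psi>]]
  by (simp add: X_def toeplitz_op_def)

lemma spectrum_A: "z \<in> spectrum F (A t) \<longleftrightarrow> symbol_minus z t \<notin> Units (bounded_ops F)"
  using spectrum_iff[OF toeplitz_sum_carrier[OF F mu_norm_summable[OF \<phi>] mu_norm_summable[OF \<psi>]]]
  by (simp add: A_def toeplitz_op_def)

text \<open>
  If \<open>X - z\<close> is invertible modulo compact operators, its two one-sided inverses bound the symbol at \<open>t\<close>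
  and the adjoint of the symbol from below, which makes the symbol invertible.
\<close>

lemma spectrum_A_subset_ess: "spectrum F (A t) \<subseteq> ess_spectrum (cyl F) X"
proof (rule subsetI, rule ccontr)
  fix z assume "z \<in> spectrum F (A t)" and "z \<notin> ess_spectrum (cyl F) X"
  then have "to_calkin (cyl F) (T_minus z) \<in> Units (calkin (cyl F))" and nu: "symbol_minus z t \<notin> Units (bounded_ops F)"
    using ess_spectrum_iff[OF toeplitz_sum_carrier[OF cyl_subset_Zpow[OF F] \<phi> \<psi>]]
    by (simp_all add: X_def toeplitz_op_def spectrum_A)
  then obtain S where S: "(S o\<^sub>L T_minus z) - proj (cyl F) \<in> compact_ops (cyl F)"
    "(T_minus z o\<^sub>L S) - proj (cyl F) \<in> compact_ops (cyl F)"
    using calkin_unit_obtain[OF carrier_T_minus] by metis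
  have "symbol_minus z t \<in> Units (bounded_ops F)"
    by (rule bounded_ops_unitI[OF carrier_symbol_minus adjoint_symbol_minus fredholm_left_symbol[OF laurent_T_minus S(1)]
          fredholm_right_symbol[OF laurent_T_adj adjoint_T_minus S(2)]])
  with nu show False ..
qed

text \<open>
  Invertible symbols give uniform lower bounds for the symbol and for its adjoint, hence lower bounds
  for \<open>X - z\<close> and for its adjoint.
\<close>

lemma spectrum_X_subset: "spectrum (cyl F) X \<subseteq> (\<Union>t\<in>{0..1}. spectrum F (A t))"
proof (rule subsetI, rule ccontr)
  fix z assume z: "z \<in> spectrum (cyl F) X" and "z \<notin> (\<Union>t\<in>{0..1}. spectrum F (A t))"
  then have u: "symbol_minus z t \<in> Units (bounded_ops F)" if "t \<in> {0..1}" for t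
    using that spectrum_A by blast
  have "T_minus z \<in> Units (bounded_ops (cyl F))"
    by (rule bounded_ops_unitI[OF carrier_T_minus adjoint_T_minus
          laurent_bounded_below[OF laurent_T_minus unit_bounded_below[OF u]]
          laurent_bounded_below[OF laurent_T_adj unit_adjoint_bounded_below[OF u adjoint_symbol_minus]]])
  with z show False by (simp add: spectrum_X)
qed

theorem cylinder_spectrum:
  "ess_spectrum (cyl F) X = spectrum (cyl F) X" "spectrum (cyl F) X = (\<Union>t\<in>{0..1}. spectrum F (A t))"
  using spectrum_A_subset_ess spectrum_X_subset
    ess_spectrum_subset_spectrum[OF toeplitz_sum_carrier[OF cyl_subset_Zpow[OF F] \<phi> \<psi>]]
  unfolding X_def[symmetric] by blast+

end

end

theorem corollary3p3:
  fixes N :: nat and \<phi> \<psi> :: "int list \<Rightarrow> real"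
  assumes "1 \<le> N"
    and "(\<lambda>x. norm (\<phi> x)) summable_on Zpow N"
    and "(\<lambda>x. norm (\<psi> x)) summable_on Zpow N"
  shows "ess_spectrum (Zless N)
           (toeplitz_T N (Zless N) (\<lambda>x. complex_of_real (\<phi> x)) +
            toeplitz_V N (Zless N) (\<lambda>x. complex_of_real (\<psi> x)))
         = spectrum (Zless N)
           (toeplitz_T N (Zless N) (\<lambda>x. complex_of_real (\<phi> x)) +
            toeplitz_V N (Zless N) (\<lambda>x. complex_of_real (\<psi> x)))
     \<and> spectrum (Zless N)
           (toeplitz_T N (Zless N) (\<lambda>x. complex_of_real (\<phi> x)) +
            toeplitz_V N (Zless N) (\<lambda>x. complex_of_real (\<psi> x)))
         = (\<Union>\<tau>\<in>{0..1::real}. spectrum (Nstar_pow (N - 1))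
             (toeplitz_T (N - 1) (Nstar_pow (N - 1)) (mu \<tau> (\<lambda>x. complex_of_real (\<phi> x))) +
              toeplitz_V (N - 1) (Nstar_pow (N - 1)) (mu 0 (\<lambda>x. complex_of_real (\<psi> x)))))"
proof -
  obtain n where N: "N = Suc n" using assms(1) by (cases N) auto
  have F: "Nstar_pow n \<subseteq> Zpow n" by (auto simp: Nstar_pow_def)
  have "(\<lambda>x. cmod (complex_of_real (\<phi> x))) summable_on Zpow (Suc n)"
    "(\<lambda>x. cmod (complex_of_real (\<psi> x))) summable_on Zpow (Suc n)"
    using assms(2,3) by (simp_all add: N)
  from cylinder_spectrum[OF F this] show ?thesis
    by (simp add: N Zless_eq_cyl)
qed

end
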